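(* Let $(G,h)$ be a simply connected nilpotent Lie group endowed with a left-invariant Riemannian metric, let $\mathfrak{g}$ be its Lie algebra with the inner product $\langle\cdot,\cdot\rangle$ induced by $h$, and let $\xi$ be a left-invariant vector field on $G$, regarded as an element of $\mathfrak{g}$. Then $\xi$ is harmonic (i.e. $\Delta\xi=0$) if and only if both of the following hold: (i) $\xi$ is in the center of $\mathfrak{g}$; (ii) $\xi\perp[\mathfrak{g},\mathfrak{g}]$, i.e. $\langle\xi,[u,v]\rangle=0$ for all $u,v\in\mathfrak{g}$.
   Context: The Lie algebra $\mathfrak{g}$ is identified with the space of left-invariant vector fields on $G$ via the canonical isomorphism. A vector field $X$ on an $n$-dimensional Riemannian manifold $(M,g)$ with Levi-Civita connection $\nabla$ is called harmonic if $\Delta X=0$, where the Laplacian on vector fields is defined by $$\Delta X=-\operatorname{tr}(\nabla^2X)=-\sum_{i=1}^n\left(\nabla_{e_i}\nabla_{e_i}X-\nabla_{\nabla_{e_i}e_i}X\right)$$ for any local orthonormal frame $\{e_1,\dots,e_n\}$ of $(M,g)$. *)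

theory Defs
  imports
    "HOL-Analysis.Analysis"
    "HOL-Library.Function_Algebras"
    "HOL-Algebra.Group"
begin

section \<open>Smooth maps between open subsets of normed spaces\<close>

text \<open>On an open subset of a finite-dimensional space the following is the usual notion of a
  \<open>C\<^sup>k\<close> map: all directional derivatives of order at most \<open>k\<close> exist and are continuous.\<close>

primrec Ck_on :: "nat \<Rightarrow> 'a::real_normed_vector set \<Rightarrow> ('a \<Rightarrow> 'b::real_normed_vector) \<Rightarrow> bool"
where
  "Ck_on 0 S f \<longleftrightarrow> continuous_on S f"
| "Ck_on (Suc k) S f \<longleftrightarrow>
     (\<forall>x\<in>S. f differentiable (at x)) \<and> (\<forall>v. Ck_on k S (\<lambda>x. frechet_derivative f (at x) v))"

definition smooth_on :: "'a::real_normed_vector set \<Rightarrow> ('a \<Rightarrow> 'b::real_normed_vector) \<Rightarrow> bool"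
  where "smooth_on S f \<longleftrightarrow> (\<forall>k. Ck_on k S f)"


section \<open>Smooth manifolds\<close>

text \<open>A chart is a pair of an open domain and a coordinate map. The type \<open>'e\<close> is the model space;
  it is required to be a finite-dimensional inner product space rather than to be of class
  \<open>euclidean_space\<close> because the latter excludes dimension \<open>0\<close>. Its inner product plays no
  role except to provide the topology.\<close>

type_synonym ('g, 'e) chart = "'g set \<times> ('g \<Rightarrow> 'e)"

abbreviation chart_inv :: "('g, 'e) chart \<Rightarrow> 'e \<Rightarrow> 'g"
  where "chart_inv c \<equiv> inv_into (fst c) (snd c)"

locale smooth_manifold =
  fixes A :: "('g::{t2_space,second_countable_topology}, 'e::real_inner) chart set"
  assumes finite_dim: "\<exists>B::'e set. finite B \<and> span B = UNIV"
    and chart_open: "c \<in> A \<Longrightarrow> open (fst c) \<and> open (snd c ` fst c)"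
    and chart_homeo: "c \<in> A \<Longrightarrow> homeomorphism (fst c) (snd c ` fst c) (snd c) (chart_inv c)"
    and chart_cover: "(\<Union>c\<in>A. fst c) = UNIV"
    and chart_compat: "c \<in> A \<Longrightarrow> d \<in> A \<Longrightarrow>
          smooth_on (snd c ` (fst c \<inter> fst d)) (snd d \<circ> chart_inv c)"

definition mfd_dim :: "('g, 'e::real_inner) chart set \<Rightarrow> nat"
  where "mfd_dim A = dim (UNIV :: 'e set)"

definition prod_atlas :: "('g, 'e) chart set \<Rightarrow> ('h, 'f) chart set \<Rightarrow> ('g \<times> 'h, 'e \<times> 'f) chart set"
  where "prod_atlas A B = {(U \<times> V, map_prod \<phi> \<psi>) | U \<phi> V \<psi>. (U, \<phi>) \<in> A \<and> (V, \<psi>) \<in> B}"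

definition smooth_map ::
    "('g::topological_space, 'e::real_inner) chart set \<Rightarrow>
     ('h::topological_space, 'f::real_inner) chart set \<Rightarrow> ('g \<Rightarrow> 'h) \<Rightarrow> bool"
  where "smooth_map A B F \<longleftrightarrow> continuous_on UNIV F \<and>
    (\<forall>c\<in>A. \<forall>d\<in>B. smooth_on (snd c ` (fst c \<inter> F -` fst d)) (snd d \<circ> F \<circ> chart_inv c))"

text \<open>\<open>smooth_fun A U f\<close>: the function \<open>f\<close> is smooth on the open set \<open>U\<close>.\<close>

definition smooth_fun ::
    "('g::topological_space, 'e::real_inner) chart set \<Rightarrow> 'g set \<Rightarrow> ('g \<Rightarrow> real) \<Rightarrow> bool"
  where "smooth_fun A U f \<longleftrightarrow> (\<forall>c\<in>A. smooth_on (snd c ` (fst c \<inter> U)) (f \<circ> chart_inv c))"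

definition smooth_near ::
    "('g::topological_space, 'e::real_inner) chart set \<Rightarrow> 'g \<Rightarrow> ('g \<Rightarrow> real) \<Rightarrow> bool"
  where "smooth_near A p f \<longleftrightarrow> (\<exists>U. open U \<and> p \<in> U \<and> smooth_fun A U f)"


section \<open>Tangent vectors and vector fields\<close>

text \<open>A tangent vector at \<open>p\<close> is an operator \<open>\<Sum>i. w\<^sub>i (\<partial>/\<partial>x\<^sub>i)\<close> on the functions that are smooth near
  \<open>p\<close>, where \<open>x\<close> are the coordinates of a chart around \<open>p\<close>. To make equality of tangent vectors
  equality in HOL, the operator is set to \<open>0\<close> on all other functions. Sums and differences of
  tangent vectors and of vector fields are the pointwise ones.\<close>

type_synonym 'g tangent = "('g \<Rightarrow> real) \<Rightarrow> real"
type_synonym 'g vfield = "'g \<Rightarrow> 'g tangent"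

definition dir_deriv ::
    "('g::topological_space, 'e::real_inner) chart set \<Rightarrow> ('g, 'e) chart \<Rightarrow> 'g \<Rightarrow> 'e \<Rightarrow> 'g tangent"
  where "dir_deriv A c p w = (\<lambda>f. if smooth_near A p f
           then frechet_derivative (f \<circ> chart_inv c) (at (snd c p)) w else 0)"

definition tangent_space ::
    "('g::topological_space, 'e::real_inner) chart set \<Rightarrow> 'g \<Rightarrow> 'g tangent set"
  where "tangent_space A p = {dir_deriv A c p w | c w. c \<in> A \<and> p \<in> fst c}"

text \<open>Smooth vector fields on an open set \<open>U\<close>; they are extended by \<open>0\<close> outside \<open>U\<close>.\<close>

definition vfields ::
    "('g::topological_space, 'e::real_inner) chart set \<Rightarrow> 'g set \<Rightarrow> 'g vfield set"
  where "vfields A U = {X.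
     (\<forall>p\<in>U. X p \<in> tangent_space A p) \<and>
     (\<forall>p. p \<notin> U \<longrightarrow> X p = 0) \<and>
     (\<forall>V f. open V \<and> V \<subseteq> U \<and> smooth_fun A V f \<longrightarrow> smooth_fun A V (\<lambda>p. X p f))}"

definition vf_restrict :: "'g set \<Rightarrow> 'g vfield \<Rightarrow> 'g vfield"
  where "vf_restrict U X = (\<lambda>p. if p \<in> U then X p else 0)"

definition vf_mult :: "('g \<Rightarrow> real) \<Rightarrow> 'g vfield \<Rightarrow> 'g vfield"
  where "vf_mult f X = (\<lambda>p u. f p * X p u)"

definition vf_apply :: "'g vfield \<Rightarrow> ('g \<Rightarrow> real) \<Rightarrow> 'g \<Rightarrow> real"
  where "vf_apply X f = (\<lambda>p. X p f)"

definition vf_scale :: "real \<Rightarrow> 'g vfield \<Rightarrow> 'g vfield"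
  where "vf_scale c X = (\<lambda>p u. c * X p u)"

lemma vector_space_vf_scale: "vector_space vf_scale"
  by unfold_locales (auto simp: vf_scale_def fun_eq_iff algebra_simps)

abbreviation vf_span :: "'g vfield set \<Rightarrow> 'g vfield set"
  where "vf_span \<equiv> module.span vf_scale"

definition lie_bracket ::
    "('g::topological_space, 'e::real_inner) chart set \<Rightarrow> 'g vfield \<Rightarrow> 'g vfield \<Rightarrow> 'g vfield"
  where "lie_bracket A X Y = (\<lambda>p f. if smooth_near A p f
           then X p (vf_apply Y f) - Y p (vf_apply X f) else 0)"


section \<open>Riemannian metrics, the Levi-Civita connection, and the Laplacian\<close>

locale riemannian_manifold = smooth_manifold A
  for A :: "('g::{t2_space,second_countable_topology}, 'e::real_inner) chart set" +
  fixes h :: "'g \<Rightarrow> 'g tangent \<Rightarrow> 'g tangent \<Rightarrow> real"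
  assumes metric_sym:
      "u \<in> tangent_space A p \<Longrightarrow> v \<in> tangent_space A p \<Longrightarrow> h p u v = h p v u"
    and metric_add:
      "u \<in> tangent_space A p \<Longrightarrow> v \<in> tangent_space A p \<Longrightarrow> w \<in> tangent_space A p \<Longrightarrow>
        h p (u + v) w = h p u w + h p v w"
    and metric_scale:
      "u \<in> tangent_space A p \<Longrightarrow> v \<in> tangent_space A p \<Longrightarrow> h p (\<lambda>f. c * u f) v = c * h p u v"
    and metric_pos:
      "u \<in> tangent_space A p \<Longrightarrow> u \<noteq> 0 \<Longrightarrow> h p u u > 0"
    and metric_smooth:
      "open U \<Longrightarrow> X \<in> vfields A U \<Longrightarrow> Y \<in> vfields A U \<Longrightarrow> smooth_fun A U (\<lambda>p. h p (X p) (Y p))"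

text \<open>A connection is given together with its restrictions to all open subsets, so that it can be
  applied to locally defined vector fields such as the members of a local frame:
  \<open>nabla U X Y\<close> is \<open>\<nabla>\<^sub>X Y\<close> for vector fields \<open>X\<close> and \<open>Y\<close> on the open set \<open>U\<close>.\<close>

locale affine_connection = smooth_manifold A
  for A :: "('g::{t2_space,second_countable_topology}, 'e::real_inner) chart set" +
  fixes nabla :: "'g set \<Rightarrow> 'g vfield \<Rightarrow> 'g vfield \<Rightarrow> 'g vfield"
  assumes nabla_closed:
      "open U \<Longrightarrow> X \<in> vfields A U \<Longrightarrow> Y \<in> vfields A U \<Longrightarrow> nabla U X Y \<in> vfields A U"
    and nabla_restrict:
      "open U \<Longrightarrow> open V \<Longrightarrow> V \<subseteq> U \<Longrightarrow> X \<in> vfields A U \<Longrightarrow> Y \<in> vfields A U \<Longrightarrow>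
        vf_restrict V (nabla U X Y) = nabla V (vf_restrict V X) (vf_restrict V Y)"
    and nabla_add_left:
      "open U \<Longrightarrow> X \<in> vfields A U \<Longrightarrow> Y \<in> vfields A U \<Longrightarrow> Z \<in> vfields A U \<Longrightarrow>
        nabla U (X + Y) Z = nabla U X Z + nabla U Y Z"
    and nabla_mult_left:
      "open U \<Longrightarrow> smooth_fun A U f \<Longrightarrow> X \<in> vfields A U \<Longrightarrow> Y \<in> vfields A U \<Longrightarrow>
        nabla U (vf_mult f X) Y = vf_mult f (nabla U X Y)"
    and nabla_add_right:
      "open U \<Longrightarrow> X \<in> vfields A U \<Longrightarrow> Y \<in> vfields A U \<Longrightarrow> Z \<in> vfields A U \<Longrightarrow>
        nabla U X (Y + Z) = nabla U X Y + nabla U X Z"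
    and nabla_leibniz:
      "open U \<Longrightarrow> smooth_fun A U f \<Longrightarrow> X \<in> vfields A U \<Longrightarrow> Y \<in> vfields A U \<Longrightarrow>
        nabla U X (vf_mult f Y) = vf_mult (vf_apply X f) Y + vf_mult f (nabla U X Y)"

locale levi_civita_connection = riemannian_manifold A h + affine_connection A nabla
  for A :: "('g::{t2_space,second_countable_topology}, 'e::real_inner) chart set"
    and h :: "'g \<Rightarrow> 'g tangent \<Rightarrow> 'g tangent \<Rightarrow> real"
    and nabla :: "'g set \<Rightarrow> 'g vfield \<Rightarrow> 'g vfield \<Rightarrow> 'g vfield" +
  assumes torsion_free:
      "open U \<Longrightarrow> X \<in> vfields A U \<Longrightarrow> Y \<in> vfields A U \<Longrightarrow>
        nabla U X Y - nabla U Y X = lie_bracket A X Y"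
    and metric_compatible:
      "open U \<Longrightarrow> X \<in> vfields A U \<Longrightarrow> Y \<in> vfields A U \<Longrightarrow> Z \<in> vfields A U \<Longrightarrow> p \<in> U \<Longrightarrow>
        X p (\<lambda>q. h q (Y q) (Z q)) = h p (nabla U X Y p) (Z p) + h p (Y p) (nabla U X Z p)"

definition orthonormal_frame ::
    "('g::topological_space, 'e::real_inner) chart set \<Rightarrow> ('g \<Rightarrow> 'g tangent \<Rightarrow> 'g tangent \<Rightarrow> real) \<Rightarrow>
     'g set \<Rightarrow> (nat \<Rightarrow> 'g vfield) \<Rightarrow> bool"
  where "orthonormal_frame A h U e \<longleftrightarrow> open U \<and> (\<forall>i<mfd_dim A. e i \<in> vfields A U) \<and>
    (\<forall>p\<in>U. \<forall>i<mfd_dim A. \<forall>j<mfd_dim A. h p (e i p) (e j p) = (if i = j then 1 else 0))"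

definition frame_laplacian ::
    "('g::topological_space, 'e::real_inner) chart set \<Rightarrow>
     ('g set \<Rightarrow> 'g vfield \<Rightarrow> 'g vfield \<Rightarrow> 'g vfield) \<Rightarrow>
     'g set \<Rightarrow> (nat \<Rightarrow> 'g vfield) \<Rightarrow> 'g vfield \<Rightarrow> 'g vfield"
  where "frame_laplacian A nabla U e X =
    - (\<Sum>i<mfd_dim A. nabla U (e i) (nabla U (e i) (vf_restrict U X))
                      - nabla U (nabla U (e i) (e i)) (vf_restrict U X))"

text \<open>The value at \<open>p\<close> is computed in a local orthonormal frame around \<open>p\<close>; it does not depend on
  the frame, because the second covariant derivative is tensorial.\<close>

definition vf_laplacian ::
    "('g::topological_space, 'e::real_inner) chart set \<Rightarrow> ('g \<Rightarrow> 'g tangent \<Rightarrow> 'g tangent \<Rightarrow> real) \<Rightarrow>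
     ('g set \<Rightarrow> 'g vfield \<Rightarrow> 'g vfield \<Rightarrow> 'g vfield) \<Rightarrow> 'g vfield \<Rightarrow> 'g vfield"
  where "vf_laplacian A h nabla X = (\<lambda>p.
    let (U, e) = (SOME (U, e). p \<in> U \<and> orthonormal_frame A h U e)
    in frame_laplacian A nabla U e X p)"

definition harmonic ::
    "('g::topological_space, 'e::real_inner) chart set \<Rightarrow> ('g \<Rightarrow> 'g tangent \<Rightarrow> 'g tangent \<Rightarrow> real) \<Rightarrow>
     ('g set \<Rightarrow> 'g vfield \<Rightarrow> 'g vfield \<Rightarrow> 'g vfield) \<Rightarrow> 'g vfield \<Rightarrow> bool"
  where "harmonic A h nabla X \<longleftrightarrow> vf_laplacian A h nabla X = 0"


section \<open>Lie groups and their Lie algebras\<close>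

locale lie_group = group G + smooth_manifold A
  for G :: "'g::{t2_space,second_countable_topology} monoid" (structure)
    and A :: "('g, 'e::real_inner) chart set" +
  assumes carrier_UNIV: "carrier G = UNIV"
    and mult_smooth: "smooth_map (prod_atlas A A) A (\<lambda>(x, y). x \<otimes> y)"
    and inv_smooth: "smooth_map A A (m_inv G)"

text \<open>The differential of left translation by \<open>a\<close>.\<close>

definition left_push :: "'g monoid \<Rightarrow> 'g \<Rightarrow> 'g tangent \<Rightarrow> 'g tangent"
  where "left_push G a v = (\<lambda>f. v (\<lambda>q. f (a \<otimes>\<^bsub>G\<^esub> q)))"

text \<open>The Lie algebra of \<open>G\<close>: the left-invariant vector fields, with \<open>lie_bracket A\<close>.\<close>

definition lie_algebra ::
    "'g::topological_space monoid \<Rightarrow> ('g, 'e::real_inner) chart set \<Rightarrow> 'g vfield set"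
  where "lie_algebra G A =
    {X \<in> vfields A UNIV. \<forall>a p. X (a \<otimes>\<^bsub>G\<^esub> p) = left_push G a (X p)}"

definition lie_center ::
    "'g::topological_space monoid \<Rightarrow> ('g, 'e::real_inner) chart set \<Rightarrow> 'g vfield set"
  where "lie_center G A = {X \<in> lie_algebra G A. \<forall>Y\<in>lie_algebra G A. lie_bracket A X Y = 0}"

primrec lower_central_series ::
    "'g::topological_space monoid \<Rightarrow> ('g, 'e::real_inner) chart set \<Rightarrow> nat \<Rightarrow> 'g vfield set"
where
  "lower_central_series G A 0 = lie_algebra G A"
| "lower_central_series G A (Suc k) =
     vf_span {lie_bracket A X Y | X Y. X \<in> lie_algebra G A \<and> Y \<in> lower_central_series G A k}"

text \<open>As usual, a connected Lie group is called nilpotent if its Lie algebra is nilpotent.\<close>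

locale nilpotent_lie_group = lie_group G A
  for G :: "'g::{t2_space,second_countable_topology} monoid" (structure)
    and A :: "('g, 'e::real_inner) chart set" +
  assumes nilpotent: "\<exists>k. lower_central_series G A k = {0}"

locale left_invariant_metric = lie_group G A + riemannian_manifold A h
  for G :: "'g::{t2_space,second_countable_topology} monoid" (structure)
    and A :: "('g, 'e::real_inner) chart set"
    and h :: "'g \<Rightarrow> 'g tangent \<Rightarrow> 'g tangent \<Rightarrow> real" +
  assumes metric_left_invariant:
      "u \<in> tangent_space A p \<Longrightarrow> v \<in> tangent_space A p \<Longrightarrow>
        h (a \<otimes> p) (left_push G a u) (left_push G a v) = h p u v"

text \<open>The inner product on the Lie algebra induced by the metric: evaluation at the identity.\<close>

definition lie_inner ::
    "'g monoid \<Rightarrow> ('g \<Rightarrow> 'g tangent \<Rightarrow> 'g tangent \<Rightarrow> real) \<Rightarrow> 'g vfield \<Rightarrow> 'g vfield \<Rightarrow> real"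
  where "lie_inner G h X Y = h \<one>\<^bsub>G\<^esub> (X \<one>\<^bsub>G\<^esub>) (Y \<one>\<^bsub>G\<^esub>)"

end

theory Submission
  imports Defs
begin

text \<open>The key fact is that a harmonic left-invariant field \<open>\<xi>\<close> is parallel. Its length is constant,
  because the metric is left-invariant too. Hence \<open>\<nabla>\<^sub>X \<xi>\<close> is orthogonal to \<open>\<xi>\<close> for every \<open>X\<close>, and
  differentiating \<open>\<langle>\<nabla>\<^sub>e \<xi>, \<xi>\<rangle> = 0\<close> once more along the members \<open>e\<^sub>i\<close> of an orthonormal frame gives the pointwise
  identity \<open>\<langle>\<Delta>\<xi>, \<xi>\<rangle> = \<Sum>\<^sub>i |\<nabla>\<^sub>e\<^sub>i \<xi>|\<^sup>2\<close> (\<open>bochner_constant_length\<close>). So \<open>\<Delta>\<xi> = 0\<close> forces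
  \<open>\<nabla>\<xi> = 0\<close>; the converse is clear (\<open>harmonic_constant_length_iff_parallel\<close>).

  The rest is algebra. If \<open>\<nabla>\<xi> = 0\<close>, then \<open>ad \<xi> = \<nabla>\<^sub>\<xi>\<close> is skew-symmetric; since the Lie algebra is
  nilpotent, \<open>ad \<xi>\<close> is also nilpotent, and a skew nilpotent map is zero
  (\<open>skew_ad_nilpotent_imp_central\<close>). Moreover \<open>\<langle>[u, v], \<xi>\<rangle> = \<langle>\<nabla>\<^sub>u v - \<nabla>\<^sub>v u, \<xi>\<rangle> = - \<langle>v, \<nabla>\<^sub>u \<xi>\<rangle> + \<langle>u, \<nabla>\<^sub>v \<xi>\<rangle> = 0\<close>.
  Conversely, centrality makes the form \<open>(X, Y) \<mapsto> \<langle>\<nabla>\<^sub>X \<xi>, Y\<rangle>\<close> skew-symmetric and orthogonality to the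
  commutators makes it symmetric, so it vanishes (\<open>central_perp_imp_parallel\<close>).

  Both directions use that there are enough left-invariant fields: every tangent vector at the
  identity extends to a smooth one (\<open>left_invariant_extension\<close>), so that the group carries a global
  left-invariant orthonormal frame. Since the Laplacian is computed in an arbitrary local
  orthonormal frame, passing between that frame and left-invariant fields
  rests on the expansion of a field in an orthonormal frame with smooth coefficients
  (\<open>frame_expansion\<close>). Smoothness of the left-invariant fields comes from the
  calculus of \<open>C\<^sup>k\<close> maps, in particular closure under composition (\<open>Ck_on_compose\<close>).\<close>

section \<open>Orthonormal families for a bilinear form\<close>

text \<open>The form \<open>Q\<close> is a parameter because two forms on the model space matter: its own inner product,
  which yields coordinates, and the Riemannian metric at a point, read in a chart.\<close>

definition orthonormal_family :: "('a \<Rightarrow> 'a \<Rightarrow> real) \<Rightarrow> nat \<Rightarrow> (nat \<Rightarrow> 'a) \<Rightarrow> bool"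
  where "orthonormal_family Q n w \<longleftrightarrow> (\<forall>i<n. \<forall>j<n. Q (w i) (w j) = (if i = j then 1 else 0))"

text \<open>Orthonormality makes the family independent, an independent family of full size spans, and applying \<open>Q\<close> to a linear combination reads off the
  coefficients.\<close>

lemma orthonormal_expansion:
  fixes Q :: "'a::real_vector \<Rightarrow> 'a \<Rightarrow> real"
  assumes fin: "\<exists>B::'a set. finite B \<and> span B = UNIV"
    and lin: "\<And>y. linear (\<lambda>x. Q x y)"
    and on: "orthonormal_family Q (dim (UNIV :: 'a set)) w"
  shows "x = (\<Sum>i<dim (UNIV :: 'a set). Q x (w i) *\<^sub>R w i)"
proof -
  define n where "n = dim (UNIV :: 'a set)"
  have on': "Q (w i) (w j) = (if i = j then 1 else 0)" if "i < n" "j < n" for i j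
    using on that by (auto simp: orthonormal_family_def n_def)
  have Qsum: "Q (\<Sum>i\<in>I. c i *\<^sub>R v i) y = (\<Sum>i\<in>I. c i * Q (v i) y)" for I :: "nat set" and c v y
    by (simp add: linear_sum[OF lin] linear_scale[OF lin])
  have inj: "inj_on w {..<n}"
    by (rule inj_onI) (metis on' lessThan_iff zero_neq_one)
  have "independent (w ` {..<n})"
  proof
    assume "dependent (w ` {..<n})"
    then obtain u v where u: "(\<Sum>v\<in>w ` {..<n}. u v *\<^sub>R v) = 0" and v: "v \<in> w ` {..<n}" "u v \<noteq> 0"
      by (auto simp: dependent_finite)
    obtain k where k: "k < n" "v = w k" using v by auto
    have "0 = Q (\<Sum>i<n. u (w i) *\<^sub>R w i) (w k)"
      using u linear_0[OF lin[of "w k"]] by (simp add: sum.reindex[OF inj])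
    also have "\<dots> = (\<Sum>i<n. u (w i) * Q (w i) (w k))" by (rule Qsum)
    also have "\<dots> = (\<Sum>i<n. if i = k then u (w k) else 0)"
      using k on' by (intro sum.cong) auto
    also have "\<dots> = u v" using k by simp
    finally show False using v by simp
  qed
  obtain B0 :: "'a set" where B0: "finite B0" "span B0 = UNIV" using fin by blast
  obtain B :: "'a set" where "independent B" "UNIV \<subseteq> span B" "card B = n"
    unfolding n_def by (rule basis_exists)
  then have B: "independent B" "span B = UNIV" "card B = n" by auto
  have finB: "finite B" using independent_span_bound[OF B0(1) B(1)] B0 by simp
  have "y \<in> span (w ` {..<n})" for y
  proof (rule ccontr)
    assume y: "y \<notin> span (w ` {..<n})"
    then have "independent (insert y (w ` {..<n}))"
      using \<open>independent (w ` {..<n})\<close> by (rule independent_insertI)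
    then have "card (insert y (w ` {..<n})) \<le> n"
      using independent_span_bound[OF finB, of "insert y (w ` {..<n})"] B by simp
    moreover have "y \<notin> w ` {..<n}" using y span_base[of y "w ` {..<n}"] by blast
    ultimately show False using card_image[OF inj] by simp
  qed
  then have "x \<in> span (w ` {..<n})" .
  then show ?thesis unfolding n_def[symmetric]
  proof (induction rule: span_induct)
    case base
    show ?case
    proof (rule subspaceI)
      show "0 \<in> {x. x = (\<Sum>i<n. Q x (w i) *\<^sub>R w i)}" by (simp add: linear_0[OF lin])
    next
      fix x y
      assume "x \<in> {x. x = (\<Sum>i<n. Q x (w i) *\<^sub>R w i)}" "y \<in> {x. x = (\<Sum>i<n. Q x (w i) *\<^sub>R w i)}"
      then have "x + y = (\<Sum>i<n. Q x (w i) *\<^sub>R w i) + (\<Sum>i<n. Q y (w i) *\<^sub>R w i)" by simp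
      also have "\<dots> = (\<Sum>i<n. Q (x + y) (w i) *\<^sub>R w i)"
        unfolding linear_add[OF lin] scaleR_left_distrib sum.distrib ..
      finally show "x + y \<in> {x. x = (\<Sum>i<n. Q x (w i) *\<^sub>R w i)}" by simp
    next
      fix c x
      assume "x \<in> {x. x = (\<Sum>i<n. Q x (w i) *\<^sub>R w i)}"
      then have "c *\<^sub>R x = c *\<^sub>R (\<Sum>i<n. Q x (w i) *\<^sub>R w i)" by simp
      also have "\<dots> = (\<Sum>i<n. Q (c *\<^sub>R x) (w i) *\<^sub>R w i)"
        by (simp only: linear_scale[OF lin] scaleR_sum_right scaleR_scaleR real_scaleR_def)
      finally show "c *\<^sub>R x \<in> {x. x = (\<Sum>i<n. Q x (w i) *\<^sub>R w i)}" by simp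
    qed
  next
    case (step x)
    then obtain k where k: "k < n" "x = w k" by auto
    have "(\<Sum>i<n. Q x (w i) *\<^sub>R w i) = (\<Sum>i<n. if i = k then w k else 0)"
      using k on' by (intro sum.cong) auto
    then show ?case using k by simp
  qed
qed

text \<open>Gram--Schmidt, by induction on a finite independent set.\<close>

lemma orthonormal_family_exists:
  fixes Q :: "'a::real_vector \<Rightarrow> 'a \<Rightarrow> real"
  assumes lin: "\<And>y. linear (\<lambda>x. Q x y)"
    and sym: "\<And>x y. Q x y = Q y x"
    and pos: "\<And>x. x \<noteq> 0 \<Longrightarrow> Q x x > 0"
    and fin: "\<exists>B::'a set. finite B \<and> span B = UNIV"
  shows "\<exists>w. orthonormal_family Q (dim (UNIV :: 'a set)) w"
proof -
  have step: "\<exists>w. orthonormal_family Q (card B) w \<and> w ` {..<card B} \<subseteq> span B"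
    if "finite B" "independent B" for B :: "'a set"
    using that
  proof (induction B)
    case empty
    then show ?case by (auto simp: orthonormal_family_def)
  next
    case (insert b B)
    have b: "b \<notin> span B" and "independent B"
      using insert.prems insert.hyps independent_insert[of b B] by auto
    then obtain w where w: "orthonormal_family Q (card B) w" "w ` {..<card B} \<subseteq> span B"
      using insert.IH by blast
    define n where "n = card B"
    define u where "u = b - (\<Sum>i<n. Q b (w i) *\<^sub>R w i)"
    have wspan: "(\<Sum>i<n. Q b (w i) *\<^sub>R w i) \<in> span B"
      using w by (intro span_sum span_scale) (auto simp: n_def)
    have "u \<noteq> 0" using b wspan unfolding u_def by auto
    have Qu: "Q u (w k) = 0" if k: "k < n" for k
    proof -
      have "Q u (w k) = Q b (w k) - (\<Sum>i<n. Q b (w i) * Q (w i) (w k))"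
        by (simp add: u_def linear_diff[OF lin] linear_sum[OF lin] linear_scale[OF lin])
      also have "(\<Sum>i<n. Q b (w i) * Q (w i) (w k)) = (\<Sum>i<n. if i = k then Q b (w k) else 0)"
        using k w by (intro sum.cong) (auto simp: n_def orthonormal_family_def)
      finally show ?thesis using k by simp
    qed
    define z where "z = (1 / sqrt (Q u u)) *\<^sub>R u"
    have Qzl: "Q z y = Q u y / sqrt (Q u u)" for y
      unfolding z_def using linear_scale[OF lin[of y]] by simp
    have Qz: "Q z (w k) = 0" "Q (w k) z = 0" if "k < n" for k
      using Qu[OF that] sym[of "w k" z] by (auto simp: Qzl)
    have "Q u z = sqrt (Q u u)"
      using pos[OF \<open>u \<noteq> 0\<close>] sym[of u z] by (simp add: Qzl real_div_sqrt)
    then have "Q z z = 1" using pos[OF \<open>u \<noteq> 0\<close>] by (simp add: Qzl)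
    have "orthonormal_family Q (Suc n) (w(n := z))"
      using w Qz \<open>Q z z = 1\<close> by (auto simp: orthonormal_family_def n_def less_Suc_eq)
    moreover have "z \<in> span (insert b B)"
      unfolding z_def u_def
      using wspan span_mono[OF subset_insertI, of B b] span_base[of b "insert b B"]
      by (intro span_scale span_diff) auto
    then have "(w(n := z)) ` {..<Suc n} \<subseteq> span (insert b B)"
      using subset_trans[OF w(2) span_mono[OF subset_insertI[of B b]]]
      by (auto simp: n_def less_Suc_eq image_subset_iff)
    ultimately have "orthonormal_family Q (Suc n) (w(n := z)) \<and> (w(n := z)) ` {..<Suc n} \<subseteq> span (insert b B)"
      by (rule conjI)
    then show ?case
      using insert.hyps by (intro exI[of _ "w(n := z)"]) (simp add: n_def del: fun_upd_apply)
  qed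
  obtain B0 :: "'a set" where B0: "finite B0" "span B0 = UNIV" using fin by blast
  obtain B :: "'a set" where B: "independent B" "card B = dim (UNIV :: 'a set)"
    by (rule basis_exists)
  have "finite B" using independent_span_bound[OF B0(1) B(1)] B0 by simp
  then show ?thesis using step[of B] B by auto
qed

text \<open>Coordinates with respect to this family are bounded linear functionals, which is what turns the
  chain rule below into a sum of products of real-valued and vector-valued maps.\<close>

lemma inner_orthonormal_basis_exists:
  assumes "\<exists>B::'a::real_inner set. finite B \<and> span B = UNIV"
  shows "\<exists>w. \<forall>x::'a. x = (\<Sum>i<dim (UNIV :: 'a set). inner x (w i) *\<^sub>R w i)"
proof -
  have lin: "linear (\<lambda>x::'a. inner x y)" for y
    by (intro bounded_linear.linear bounded_linear_inner_left)
  obtain w where w: "orthonormal_family (inner :: 'a \<Rightarrow> _) (dim (UNIV :: 'a set)) w"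
    using orthonormal_family_exists[of inner, OF lin inner_commute _ assms] by auto
  show ?thesis using orthonormal_expansion[OF assms lin w] by blast
qed

section \<open>Calculus of smooth maps\<close>

text \<open>The Frechet derivative is a choice operator, so locally equal functions have literally equal
  derivatives, even where neither is differentiable.\<close>

lemma frechet_derivative_cong_open:
  assumes "open S" "x \<in> S" "\<And>y. y \<in> S \<Longrightarrow> f y = g y"
  shows "frechet_derivative f (at x) = frechet_derivative g (at x)"
proof -
  have "(f has_derivative D) (at x) \<longleftrightarrow> (g has_derivative D) (at x)" for D
    using has_derivative_transform_within_open[OF _ assms(1,2), of f D UNIV g]
      has_derivative_transform_within_open[OF _ assms(1,2), of g D UNIV f] assms(3) by auto
  then show ?thesis by (simp add: frechet_derivative_def)
qed

lemma Ck_on_cong: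
  assumes "open S" "\<And>x. x \<in> S \<Longrightarrow> f x = g x" "Ck_on k S f"
  shows "Ck_on k S g"
  using assms(2,3)
proof (induction k arbitrary: f g)
  case 0
  then show ?case using continuous_on_cong by auto
next
  case (Suc k)
  have "g differentiable at x" if x: "x \<in> S" for x
  proof -
    obtain D where "(f has_derivative D) (at x)"
      using Suc.prems(2) x by (auto simp: differentiable_def)
    then have "(g has_derivative D) (at x)"
      using has_derivative_transform_within_open[OF _ assms(1) x, of f D UNIV g] Suc.prems(1) by simp
    then show ?thesis by (auto simp: differentiable_def)
  qed
  moreover have "Ck_on k S (\<lambda>x. frechet_derivative g (at x) v)" for v
  proof (rule Suc.IH)
    show "Ck_on k S (\<lambda>x. frechet_derivative f (at x) v)" using Suc.prems(2) by simp
    show "frechet_derivative f (at x) v = frechet_derivative g (at x) v" if "x \<in> S" for x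
      using frechet_derivative_cong_open[OF assms(1) that Suc.prems(1)] by simp
  qed
  ultimately show ?case by simp
qed

lemma Ck_on_SucI:
  assumes "open S" "\<And>x. x \<in> S \<Longrightarrow> (f has_derivative f' x) (at x)" "\<And>v. Ck_on k S (\<lambda>x. f' x v)"
  shows "Ck_on (Suc k) S f"
proof -
  have "Ck_on k S (\<lambda>x. frechet_derivative f (at x) v)" for v
    by (rule Ck_on_cong[OF assms(1) _ assms(3)[of v]])
      (simp add: frechet_derivative_at[OF assms(2), symmetric])
  moreover have "f differentiable at x" if "x \<in> S" for x
    using assms(2)[OF that] unfolding differentiable_def by blast
  ultimately show ?thesis by simp
qed

lemma Ck_on_has_derivative:
  "Ck_on (Suc k) S f \<Longrightarrow> x \<in> S \<Longrightarrow> (f has_derivative frechet_derivative f (at x)) (at x)"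
  by (simp add: frechet_derivative_works[symmetric])

lemma Ck_on_Suc_imp: "Ck_on (Suc k) S f \<Longrightarrow> Ck_on k S f"
proof (induction k arbitrary: f)
  case 0
  then show ?case
    by (auto intro!: continuous_at_imp_continuous_on differentiable_imp_continuous_within)
next
  case (Suc k)
  have "Ck_on k S (\<lambda>x. frechet_derivative f (at x) v)" for v
    by (rule Suc.IH) (use Suc.prems in simp)
  then show ?case using Suc.prems by simp
qed

lemma Ck_on_subset: "Ck_on k S f \<Longrightarrow> T \<subseteq> S \<Longrightarrow> Ck_on k T f"
  by (induction k arbitrary: f) (auto intro: continuous_on_subset)

lemma Ck_on_local:
  assumes "\<And>x. x \<in> S \<Longrightarrow> \<exists>T. open T \<and> x \<in> T \<and> Ck_on k T f"
  shows "Ck_on k S f"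
  using assms
proof (induction k arbitrary: f)
  case 0
  show ?case unfolding Ck_on.simps
  proof (rule continuous_at_imp_continuous_on, rule ballI)
    fix x assume "x \<in> S"
    then obtain T where "open T" "x \<in> T" "continuous_on T f" using 0 by auto
    then show "isCont f x" using continuous_on_eq_continuous_at by blast
  qed
next
  case (Suc k)
  have "Ck_on k S (\<lambda>x. frechet_derivative f (at x) v)" for v
  proof (rule Suc.IH)
    fix x assume "x \<in> S"
    then obtain T where "open T" "x \<in> T" "Ck_on (Suc k) T f" using Suc.prems by blast
    then show "\<exists>T. open T \<and> x \<in> T \<and> Ck_on k T (\<lambda>x. frechet_derivative f (at x) v)"
      by (intro exI[of _ T]) simp
  qed
  moreover have "f differentiable at x" if "x \<in> S" for x
    using Suc.prems[OF that] by auto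
  ultimately show ?case by simp
qed

lemma Ck_on_const: "open S \<Longrightarrow> Ck_on k S (\<lambda>x. c)"
proof (induction k arbitrary: c)
  case (Suc k)
  then show ?case by (intro Ck_on_SucI[where f'="\<lambda>_ _. 0"]) auto
qed simp

lemma Ck_on_add:
  assumes "open S" "Ck_on k S f" "Ck_on k S g"
  shows "Ck_on k S (\<lambda>x. f x + g x)"
  using assms(2,3)
proof (induction k arbitrary: f g)
  case 0
  then show ?case by (auto intro: continuous_on_add)
next
  case (Suc k)
  show ?case
    using Suc Ck_on_has_derivative[OF Suc.prems(1)] Ck_on_has_derivative[OF Suc.prems(2)]
    by (intro Ck_on_SucI[OF assms(1), where f'="\<lambda>x v. frechet_derivative f (at x) v + frechet_derivative g (at x) v"]
        has_derivative_add) auto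
qed

lemma Ck_on_sum:
  assumes "open S" "\<And>i. i \<in> I \<Longrightarrow> Ck_on k S (f i)"
  shows "Ck_on k S (\<lambda>x. \<Sum>i\<in>I. f i x)"
  using assms(2)
  by (induction I rule: infinite_finite_induct) (auto intro: Ck_on_const Ck_on_add assms(1))

lemma Ck_on_scaleR:
  assumes "open S" "Ck_on k S f" "Ck_on k S g"
  shows "Ck_on k S (\<lambda>x. f x *\<^sub>R g x)"
  using assms(2,3)
proof (induction k arbitrary: f g)
  case 0
  then show ?case by (auto intro: continuous_on_scaleR)
next
  case (Suc k)
  have "Ck_on k S (\<lambda>x. f x *\<^sub>R frechet_derivative g (at x) v + frechet_derivative f (at x) v *\<^sub>R g x)" for v
    using Suc Ck_on_Suc_imp[OF Suc.prems(1)] Ck_on_Suc_imp[OF Suc.prems(2)]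
    by (intro Ck_on_add[OF assms(1)] Suc.IH) auto
  then show ?case
    using Ck_on_has_derivative[OF Suc.prems(1)] Ck_on_has_derivative[OF Suc.prems(2)]
    by (intro Ck_on_SucI[OF assms(1), where
          f'="\<lambda>x v. f x *\<^sub>R frechet_derivative g (at x) v + frechet_derivative f (at x) v *\<^sub>R g x"]
        has_derivative_scaleR) auto
qed

lemma Ck_on_bounded_linear:
  assumes "open S" "bounded_linear L" "Ck_on k S f"
  shows "Ck_on k S (\<lambda>x. L (f x))"
  using assms(3)
proof (induction k arbitrary: f)
  case 0
  then show ?case using bounded_linear.continuous_on[OF assms(2)] by auto
next
  case (Suc k)
  show ?case
    using Suc Ck_on_has_derivative[OF Suc.prems]
    by (intro Ck_on_SucI[OF assms(1), where f'="\<lambda>x v. L (frechet_derivative f (at x) v)"]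
        bounded_linear.has_derivative[OF assms(2)]) auto
qed

text \<open>Partial derivatives of a function of two variables are handled by the affine maps \<open>x \<mapsto> (x, b)\<close>
  and \<open>y \<mapsto> (a, y)\<close>. Each directional derivative of a composite with an affine
  inner map is again a composite with the same map, in the direction transformed by \<open>L\<close>; this drives
  the induction.\<close>

lemma Ck_on_compose_affine:
  assumes "open S" "bounded_linear L" "\<And>x. x \<in> S \<Longrightarrow> L x + a \<in> T" "Ck_on k T f"
  shows "Ck_on k S (\<lambda>x. f (L x + a))"
  using assms(4)
proof (induction k arbitrary: f)
  case 0
  have "continuous_on S (\<lambda>x. L x + a)"
    by (intro continuous_intros linear_continuous_on assms(2))
  with 0 show ?case
    using continuous_on_compose2[of T f S "\<lambda>x. L x + a"] assms(3) by auto
next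
  case (Suc k)
  have "((\<lambda>x. L x + a) has_derivative L) (at x)" for x
    using has_derivative_add_const[OF bounded_linear.has_derivative[OF assms(2) has_derivative_ident]] by simp
  then have "((\<lambda>x. f (L x + a)) has_derivative (\<lambda>v. frechet_derivative f (at (L x + a)) (L v))) (at x)"
    if "x \<in> S" for x
    using has_derivative_compose Ck_on_has_derivative[OF Suc.prems assms(3)[OF that]] by blast
  then show ?case
    using Suc by (intro Ck_on_SucI[OF assms(1), where
        f'="\<lambda>x v. frechet_derivative f (at (L x + a)) (L v)"]) auto
qed

text \<open>Expanding \<open>Df(x)v\<close> in coordinates, \<open>D(g \<circ> f)(x)v = \<Sum>\<^sub>i \<langle>Df(x)v, w\<^sub>i\<rangle> (Dg(\<cdot>)w\<^sub>i)(f x)\<close>. Only directional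
  derivatives of \<open>g\<close> in the fixed directions \<open>w\<^sub>i\<close> occur, and to these the induction hypothesis
  applies with the same \<open>f\<close>.\<close>

lemma Ck_on_compose:
  fixes f :: "'a::real_normed_vector \<Rightarrow> 'b::real_inner" and g :: "'b \<Rightarrow> 'c::real_normed_vector"
  assumes fin: "\<exists>B::'b set. finite B \<and> span B = UNIV"
    and S: "open S" and ST: "\<And>x. x \<in> S \<Longrightarrow> f x \<in> T"
    and "Ck_on k S f" "Ck_on k T g"
  shows "Ck_on k S (\<lambda>x. g (f x))"
  using assms(4,5)
proof (induction k arbitrary: g)
  case 0
  then show ?case
    using continuous_on_compose2[of T g S f] ST by auto
next
  case (Suc k)
  obtain w where w: "\<And>y::'b. y = (\<Sum>i<dim (UNIV :: 'b set). inner y (w i) *\<^sub>R w i)"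
    using inner_orthonormal_basis_exists[OF fin] by blast
  have D: "((\<lambda>x. g (f x)) has_derivative (\<lambda>v. frechet_derivative g (at (f x)) (frechet_derivative f (at x) v))) (at x)"
    if "x \<in> S" for x
    using that Ck_on_has_derivative[OF Suc.prems(1)] Ck_on_has_derivative[OF Suc.prems(2) ST]
    by (blast intro: has_derivative_compose)
  have "Ck_on k S (\<lambda>x. frechet_derivative g (at (f x)) (frechet_derivative f (at x) v))" for v
  proof (rule Ck_on_cong[OF S])
    show "Ck_on k S (\<lambda>x. \<Sum>i<dim (UNIV :: 'b set).
        inner (frechet_derivative f (at x) v) (w i) *\<^sub>R frechet_derivative g (at (f x)) (w i))"
      using Suc Ck_on_Suc_imp[OF Suc.prems(1)]
      by (intro Ck_on_sum Ck_on_scaleR S Ck_on_bounded_linear[OF S bounded_linear_inner_left] Suc.IH) auto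
    fix x assume "x \<in> S"
    have lin: "linear (frechet_derivative g (at (f x)))"
      using Ck_on_has_derivative[OF Suc.prems(2) ST[OF \<open>x \<in> S\<close>]] has_derivative_linear by blast
    have "frechet_derivative g (at (f x)) y =
        (\<Sum>i<dim (UNIV :: 'b set). inner y (w i) *\<^sub>R frechet_derivative g (at (f x)) (w i))" for y
    proof -
      have "frechet_derivative g (at (f x)) y =
          frechet_derivative g (at (f x)) (\<Sum>i<dim (UNIV :: 'b set). inner y (w i) *\<^sub>R w i)"
        by (rule arg_cong[OF w])
      also have "\<dots> = (\<Sum>i<dim (UNIV :: 'b set). inner y (w i) *\<^sub>R frechet_derivative g (at (f x)) (w i))"
        by (simp only: linear_sum[OF lin] linear_scale[OF lin])
      finally show ?thesis .
    qed
    then show "(\<Sum>i<dim (UNIV :: 'b set). inner (frechet_derivative f (at x) v) (w i) *\<^sub>R frechet_derivative g (at (f x)) (w i))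
        = frechet_derivative g (at (f x)) (frechet_derivative f (at x) v)"
      by (rule sym)
  qed
  then show ?case using D by (intro Ck_on_SucI[OF S]) auto
qed

lemma smooth_on_cong:
  "open S \<Longrightarrow> (\<And>x. x \<in> S \<Longrightarrow> f x = g x) \<Longrightarrow> smooth_on S f \<Longrightarrow> smooth_on S g"
  unfolding smooth_on_def using Ck_on_cong by blast

lemma smooth_on_subset: "smooth_on S f \<Longrightarrow> T \<subseteq> S \<Longrightarrow> smooth_on T f"
  unfolding smooth_on_def using Ck_on_subset by blast

lemma smooth_on_local:
  "(\<And>x. x \<in> S \<Longrightarrow> \<exists>T. open T \<and> x \<in> T \<and> smooth_on T f) \<Longrightarrow> smooth_on S f"
  unfolding smooth_on_def by (meson Ck_on_local)

lemma smooth_on_const: "open S \<Longrightarrow> smooth_on S (\<lambda>x. c)"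
  by (simp add: smooth_on_def Ck_on_const)

lemma smooth_on_add: "open S \<Longrightarrow> smooth_on S f \<Longrightarrow> smooth_on S g \<Longrightarrow> smooth_on S (\<lambda>x. f x + g x)"
  by (simp add: smooth_on_def Ck_on_add)

lemma smooth_on_mult:
  fixes f g :: "_ \<Rightarrow> real"
  shows "open S \<Longrightarrow> smooth_on S f \<Longrightarrow> smooth_on S g \<Longrightarrow> smooth_on S (\<lambda>x. f x * g x)"
  using Ck_on_scaleR[of S _ f g] by (simp add: smooth_on_def)

lemma smooth_on_bounded_linear:
  "open S \<Longrightarrow> bounded_linear L \<Longrightarrow> smooth_on S f \<Longrightarrow> smooth_on S (\<lambda>x. L (f x))"
  by (simp add: smooth_on_def Ck_on_bounded_linear)

lemma smooth_on_compose_affine: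
  "open S \<Longrightarrow> bounded_linear L \<Longrightarrow> (\<And>x. x \<in> S \<Longrightarrow> L x + a \<in> T) \<Longrightarrow> smooth_on T f
    \<Longrightarrow> smooth_on S (\<lambda>x. f (L x + a))"
  unfolding smooth_on_def using Ck_on_compose_affine by blast

lemma smooth_on_compose:
  fixes f :: "'a::real_normed_vector \<Rightarrow> 'b::real_inner"
  shows "\<exists>B::'b set. finite B \<and> span B = UNIV \<Longrightarrow> open S \<Longrightarrow> (\<And>x. x \<in> S \<Longrightarrow> f x \<in> T)
    \<Longrightarrow> smooth_on S f \<Longrightarrow> smooth_on T g \<Longrightarrow> smooth_on S (\<lambda>x. g (f x))"
  unfolding smooth_on_def using Ck_on_compose[of S f T] by blast

lemma smooth_on_frechet_derivative:
  "smooth_on S f \<Longrightarrow> smooth_on S (\<lambda>x. frechet_derivative f (at x) v)"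
  unfolding smooth_on_def using Ck_on.simps(2) by blast

lemma smooth_on_has_derivative:
  "smooth_on S f \<Longrightarrow> x \<in> S \<Longrightarrow> (f has_derivative frechet_derivative f (at x)) (at x)"
  unfolding smooth_on_def using Ck_on_has_derivative by blast

section \<open>Functions, tangent vectors and vector fields on a manifold\<close>

lemma sum_fun_apply: "(\<Sum>i\<in>I. F i) x = (\<Sum>i\<in>I. F i x)"
  by (induction I rule: infinite_finite_induct) auto

lemma smooth_fun_subset: "smooth_fun A V f \<Longrightarrow> W \<subseteq> V \<Longrightarrow> smooth_fun A W f"
  unfolding smooth_fun_def by (meson Int_mono image_mono order_refl smooth_on_subset)

lemma vf_restrict_apply: "p \<in> U \<Longrightarrow> vf_restrict U X p = X p"
  by (simp add: vf_restrict_def)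

context smooth_manifold
begin

lemma chart_at: obtains c where "c \<in> A" "p \<in> fst c"
  using chart_cover by blast

lemma chart_left: "c \<in> A \<Longrightarrow> p \<in> fst c \<Longrightarrow> chart_inv c (snd c p) = p"
  using chart_homeo[of c] homeomorphism_apply1 by blast

lemma chart_right:
  assumes "c \<in> A" "x \<in> snd c ` fst c"
  shows "snd c (chart_inv c x) = x" "chart_inv c x \<in> fst c"
  using assms by (auto simp: chart_left)

lemma chart_preimage_open:
  assumes "c \<in> A" "open V"
  shows "open (snd c ` (fst c \<inter> V))"
proof -
  have "snd c ` (fst c \<inter> V) = snd c ` fst c \<inter> chart_inv c -` V"
    using chart_left[OF assms(1)] by auto
  moreover have "continuous_on (snd c ` fst c) (chart_inv c)"
    using chart_homeo[OF assms(1)] by (simp add: homeomorphism_def)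
  ultimately show ?thesis
    using continuous_open_preimage[of "snd c ` fst c" "chart_inv c" V] chart_open[OF assms(1)] assms(2)
    by simp
qed

text \<open>Smoothness may be tested near each point in a single chart: the transition maps carry it over to
  all the others.\<close>

lemma smooth_fun_chartsI:
  assumes "\<And>p. p \<in> V \<Longrightarrow> \<exists>c\<in>A. \<exists>W. open W \<and> p \<in> W \<and> W \<subseteq> fst c \<and>
      smooth_on (snd c ` W) (f \<circ> chart_inv c)"
  shows "smooth_fun A V f"
  unfolding smooth_fun_def
proof (intro ballI smooth_on_local)
  fix d x assume d: "d \<in> A" and "x \<in> snd d ` (fst d \<inter> V)"
  then obtain p where p: "p \<in> fst d" "p \<in> V" "x = snd d p" by auto
  then obtain c W where c: "c \<in> A" "open W" "p \<in> W" "W \<subseteq> fst c"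
      "smooth_on (snd c ` W) (f \<circ> chart_inv c)"
    using assms by blast
  let ?T = "snd d ` (fst d \<inter> W)"
  have T: "open ?T" using chart_preimage_open d c(2) by blast
  have "smooth_on ?T (snd c \<circ> chart_inv d)"
    using chart_compat[OF d c(1)] by (rule smooth_on_subset) (use c(4) in auto)
  moreover have "(snd c \<circ> chart_inv d) y \<in> snd c ` W" if "y \<in> ?T" for y
    using that chart_left[OF d] by auto
  ultimately have "smooth_on ?T (\<lambda>y. (f \<circ> chart_inv c) ((snd c \<circ> chart_inv d) y))"
    using smooth_on_compose[OF finite_dim T _ _ c(5)] by blast
  then have "smooth_on ?T (f \<circ> chart_inv d)"
    by (rule smooth_on_cong[OF T, rotated])
      (use chart_left[OF d] chart_left[OF c(1)] c(4) in \<open>auto simp: subset_iff\<close>)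
  moreover have "x \<in> ?T" using p c(3) by blast
  ultimately show "\<exists>T. open T \<and> x \<in> T \<and> smooth_on T (f \<circ> chart_inv d)"
    using T by blast
qed

lemma smooth_fun_cong:
  assumes "open V" "\<And>p. p \<in> V \<Longrightarrow> f p = g p" "smooth_fun A V f"
  shows "smooth_fun A V g"
  unfolding smooth_fun_def
proof
  fix c assume c: "c \<in> A"
  show "smooth_on (snd c ` (fst c \<inter> V)) (g \<circ> chart_inv c)"
    using chart_preimage_open[OF c assms(1)]
    by (rule smooth_on_cong[where f="f \<circ> chart_inv c"])
      (use assms(2,3) c chart_left[OF c] in \<open>auto simp: smooth_fun_def\<close>)
qed

lemma smooth_fun_const: "open V \<Longrightarrow> smooth_fun A V (\<lambda>p. r)"
  unfolding smooth_fun_def comp_def by (simp add: smooth_on_const chart_preimage_open)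

lemma smooth_fun_add:
  "open V \<Longrightarrow> smooth_fun A V f \<Longrightarrow> smooth_fun A V g \<Longrightarrow> smooth_fun A V (\<lambda>p. f p + g p)"
  unfolding smooth_fun_def comp_def by (simp add: smooth_on_add chart_preimage_open)

lemma smooth_fun_mult:
  "open V \<Longrightarrow> smooth_fun A V f \<Longrightarrow> smooth_fun A V g \<Longrightarrow> smooth_fun A V (\<lambda>p. f p * g p)"
  unfolding smooth_fun_def comp_def by (simp add: smooth_on_mult chart_preimage_open)

lemma smooth_nearI: "open U \<Longrightarrow> p \<in> U \<Longrightarrow> smooth_fun A U f \<Longrightarrow> smooth_near A p f"
  unfolding smooth_near_def by blast

lemma smooth_near_cong:
  assumes "open U" "p \<in> U" "\<And>q. q \<in> U \<Longrightarrow> f q = g q" "smooth_near A p f"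
  shows "smooth_near A p g"
proof -
  obtain V where V: "open V" "p \<in> V" "smooth_fun A V f"
    using assms(4) unfolding smooth_near_def by blast
  have "smooth_fun A (U \<inter> V) g"
    by (rule smooth_fun_cong[where f=f]) (use V assms smooth_fun_subset[OF V(3)] in auto)
  then show ?thesis using smooth_nearI[of "U \<inter> V"] V assms by auto
qed

lemma smooth_near_has_derivative:
  assumes "smooth_near A p f" "c \<in> A" "p \<in> fst c"
  shows "((f \<circ> chart_inv c) has_derivative frechet_derivative (f \<circ> chart_inv c) (at (snd c p))) (at (snd c p))"
proof -
  obtain V where V: "open V" "p \<in> V" "smooth_fun A V f"
    using assms(1) unfolding smooth_near_def by blast
  then have "smooth_on (snd c ` (fst c \<inter> V)) (f \<circ> chart_inv c)"
    using assms(2) unfolding smooth_fun_def by blast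
  then show ?thesis
    by (rule smooth_on_has_derivative) (use V assms in auto)
qed

lemma dir_deriv_cong:
  assumes U: "open U" "p \<in> U" "\<And>q. q \<in> U \<Longrightarrow> f q = g q" and c: "c \<in> A" "p \<in> fst c"
  shows "dir_deriv A c p w f = dir_deriv A c p w g"
proof -
  have "frechet_derivative (f \<circ> chart_inv c) (at (snd c p)) = frechet_derivative (g \<circ> chart_inv c) (at (snd c p))"
    by (rule frechet_derivative_cong_open[OF chart_preimage_open[OF c(1) U(1)]])
      (use U c chart_left in auto)
  moreover have "smooth_near A p f \<longleftrightarrow> smooth_near A p g"
    using smooth_near_cong[OF U(1,2), of f g] smooth_near_cong[OF U(1,2), of g f] U(3) by auto
  ultimately show ?thesis by (simp add: dir_deriv_def)
qed

lemma dir_deriv_linear: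
  assumes "c \<in> A" "p \<in> fst c"
  shows "linear (\<lambda>w. dir_deriv A c p w f)"
proof (cases "smooth_near A p f")
  case True
  show ?thesis
    using has_derivative_linear[OF smooth_near_has_derivative[OF True assms]] True
    by (simp add: dir_deriv_def)
next
  case False
  then show ?thesis by (simp add: dir_deriv_def linear_zero)
qed

lemma dir_deriv_add:
  "c \<in> A \<Longrightarrow> p \<in> fst c \<Longrightarrow> dir_deriv A c p (v + w) = dir_deriv A c p v + dir_deriv A c p w"
  using linear_add[OF dir_deriv_linear] by (simp add: fun_eq_iff)

lemma dir_deriv_scale:
  "c \<in> A \<Longrightarrow> p \<in> fst c \<Longrightarrow> dir_deriv A c p (r *\<^sub>R w) = (\<lambda>f. r * dir_deriv A c p w f)"
  using linear_scale[OF dir_deriv_linear] by (simp add: fun_eq_iff)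

lemma dir_deriv_zero: "c \<in> A \<Longrightarrow> p \<in> fst c \<Longrightarrow> dir_deriv A c p 0 = 0"
  using linear_0[OF dir_deriv_linear] by (simp add: fun_eq_iff)

lemma dir_deriv_sum:
  "c \<in> A \<Longrightarrow> p \<in> fst c \<Longrightarrow> dir_deriv A c p (\<Sum>i\<in>I. r i *\<^sub>R w i) = (\<lambda>f. \<Sum>i\<in>I. r i * dir_deriv A c p (w i) f)"
  by (simp add: fun_eq_iff linear_sum[OF dir_deriv_linear] linear_scale[OF dir_deriv_linear])

text \<open>The chain rule for the transition map; it makes the tangent space at \<open>p\<close> a copy of the model space
  through any one chart around \<open>p\<close>.\<close>

lemma dir_deriv_change_chart:
  assumes c: "c \<in> A" "p \<in> fst c" and d: "d \<in> A" "p \<in> fst d"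
  shows "dir_deriv A c p w = dir_deriv A d p (frechet_derivative (snd d \<circ> chart_inv c) (at (snd c p)) w)"
proof
  fix f
  show "dir_deriv A c p w f = dir_deriv A d p (frechet_derivative (snd d \<circ> chart_inv c) (at (snd c p)) w) f"
  proof (cases "smooth_near A p f")
    case True
    let ?T = "snd c ` (fst c \<inter> fst d)"
    let ?t = "snd d \<circ> chart_inv c"
    have T: "open ?T" "snd c p \<in> ?T"
      using chart_preimage_open c chart_open[OF d(1)] d by auto
    have D1: "(?t has_derivative frechet_derivative ?t (at (snd c p))) (at (snd c p))"
      using smooth_on_has_derivative[OF chart_compat[OF c(1) d(1)] T(2)] .
    have D2: "((f \<circ> chart_inv d) has_derivative frechet_derivative (f \<circ> chart_inv d) (at (snd d p))) (at (?t (snd c p)))"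
      using smooth_near_has_derivative[OF True d] chart_left[OF c] by simp
    have "((\<lambda>y. (f \<circ> chart_inv d) (?t y)) has_derivative
        (\<lambda>v. frechet_derivative (f \<circ> chart_inv d) (at (snd d p)) (frechet_derivative ?t (at (snd c p)) v))) (at (snd c p))"
      using has_derivative_compose[OF D1 D2] .
    then have "((f \<circ> chart_inv c) has_derivative
        (\<lambda>v. frechet_derivative (f \<circ> chart_inv d) (at (snd d p)) (frechet_derivative ?t (at (snd c p)) v))) (at (snd c p))"
      by (rule has_derivative_transform_within_open[OF _ T])
        (use chart_left c d in auto)
    then show ?thesis
      using True by (simp add: dir_deriv_def frechet_derivative_at[symmetric])
  qed (simp add: dir_deriv_def)
qed

lemma tangent_space_eq:
  assumes "c \<in> A" "p \<in> fst c"
  shows "tangent_space A p = range (dir_deriv A c p)"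
  using assms dir_deriv_change_chart[OF _ _ assms] unfolding tangent_space_def by blast

text \<open>Tangent vectors are local, although they act on functions defined on the whole manifold. This
  allows functions whose behaviour is known only on an open set, such as inner products of
  locally defined fields.\<close>

lemma tangent_cong:
  assumes "v \<in> tangent_space A p" "open U" "p \<in> U" "\<And>q. q \<in> U \<Longrightarrow> f q = g q"
  shows "v f = v g"
  using assms(1) dir_deriv_cong[OF assms(2-4)] unfolding tangent_space_def by auto

lemma tangent_locally_const:
  assumes "v \<in> tangent_space A p" "open U" "p \<in> U" "\<And>q. q \<in> U \<Longrightarrow> f q = r"
  shows "v f = 0"
proof -
  have "v f = v (\<lambda>q. r)" using tangent_cong[OF assms] .
  moreover obtain c w where "c \<in> A" "p \<in> fst c" "v = dir_deriv A c p w"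
    using assms(1) unfolding tangent_space_def by blast
  ultimately show ?thesis by (simp add: dir_deriv_def comp_def)
qed

lemma coordinate_smooth_near:
  assumes "c \<in> A" "p \<in> fst c"
  shows "smooth_near A p (\<lambda>q. inner (snd c q) b)"
proof (rule smooth_nearI)
  show "open (fst c)" "p \<in> fst c" using assms chart_open by auto
  show "smooth_fun A (fst c) (\<lambda>q. inner (snd c q) b)"
    unfolding smooth_fun_def
  proof
    fix d assume "d \<in> A"
    then show "smooth_on (snd d ` (fst d \<inter> fst c)) ((\<lambda>q. inner (snd c q) b) \<circ> chart_inv d)"
      using smooth_on_bounded_linear[OF chart_preimage_open bounded_linear_inner_left chart_compat]
        chart_open assms
      by (simp add: comp_def)
  qed
qed

text \<open>The coordinates of a chart separate directions: the direction \<open>w\<close> is detected by the function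
  \<open>q \<mapsto> \<langle>x(q), w\<rangle>\<close>, whose derivative along \<open>w\<close> is \<open>\<langle>w, w\<rangle>\<close>.\<close>

lemma dir_deriv_eq_0_iff:
  assumes "c \<in> A" "p \<in> fst c"
  shows "dir_deriv A c p w = 0 \<longleftrightarrow> w = 0"
proof
  assume 0: "dir_deriv A c p w = 0"
  let ?f = "\<lambda>q. inner (snd c q) w"
  have "open (snd c ` fst c)" "snd c p \<in> snd c ` fst c" using assms chart_open by auto
  moreover have "((\<lambda>x. inner x w) has_derivative (\<lambda>x. inner x w)) (at (snd c p))"
    by (rule bounded_linear_imp_has_derivative) (rule bounded_linear_inner_left)
  ultimately have "((?f \<circ> chart_inv c) has_derivative (\<lambda>x. inner x w)) (at (snd c p))"
    using has_derivative_transform_within_open[of "\<lambda>x. inner x w" "\<lambda>x. inner x w" "snd c p" UNIV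
        "snd c ` fst c" "?f \<circ> chart_inv c"] chart_right[OF assms(1)] by simp
  then have "inner w w = dir_deriv A c p w ?f"
    using coordinate_smooth_near[OF assms] by (simp add: dir_deriv_def frechet_derivative_at[symmetric])
  then show "w = 0" using 0 by simp
qed (simp add: dir_deriv_zero assms)

lemma tangent_add:
  assumes "u \<in> tangent_space A p" "v \<in> tangent_space A p"
  shows "u + v \<in> tangent_space A p"
proof -
  obtain c where c: "c \<in> A" "p \<in> fst c" by (rule chart_at)
  then show ?thesis
    using assms dir_deriv_add[OF c, symmetric] by (auto simp: tangent_space_eq[OF c])
qed

lemma tangent_scale:
  assumes "u \<in> tangent_space A p"
  shows "(\<lambda>f. r * u f) \<in> tangent_space A p"
proof -
  obtain c where c: "c \<in> A" "p \<in> fst c" by (rule chart_at)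
  then show ?thesis
    using assms dir_deriv_scale[OF c, symmetric] by (auto simp: tangent_space_eq[OF c])
qed

lemma tangent_zero: "0 \<in> tangent_space A p"
proof -
  obtain c where c: "c \<in> A" "p \<in> fst c" by (rule chart_at)
  then show ?thesis
    using dir_deriv_zero[OF c, symmetric] by (auto simp: tangent_space_eq[OF c])
qed

lemma vfields_tangent: "X \<in> vfields A U \<Longrightarrow> X p \<in> tangent_space A p"
  unfolding vfields_def by (cases "p \<in> U") (auto simp: tangent_zero)

lemma vfields_outside: "X \<in> vfields A U \<Longrightarrow> p \<notin> U \<Longrightarrow> X p = 0"
  unfolding vfields_def by auto

lemma vfields_smooth:
  "X \<in> vfields A U \<Longrightarrow> open V \<Longrightarrow> V \<subseteq> U \<Longrightarrow> smooth_fun A V f \<Longrightarrow> smooth_fun A V (\<lambda>p. X p f)"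
  unfolding vfields_def by auto

lemma vfieldsI:
  assumes "\<And>p. p \<in> U \<Longrightarrow> X p \<in> tangent_space A p" "\<And>p. p \<notin> U \<Longrightarrow> X p = 0"
    "\<And>V f. open V \<Longrightarrow> V \<subseteq> U \<Longrightarrow> smooth_fun A V f \<Longrightarrow> smooth_fun A V (\<lambda>p. X p f)"
  shows "X \<in> vfields A U"
  using assms unfolding vfields_def by auto

lemma vfields_zero: "0 \<in> vfields A U"
  by (rule vfieldsI) (auto simp: tangent_zero smooth_fun_const)

lemma vfields_add:
  assumes "X \<in> vfields A U" "Y \<in> vfields A U"
  shows "X + Y \<in> vfields A U"
proof (rule vfieldsI)
  show "smooth_fun A V (\<lambda>p. (X + Y) p f)" if "open V" "V \<subseteq> U" "smooth_fun A V f" for V f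
    using smooth_fun_add[OF that(1) vfields_smooth[OF assms(1) that] vfields_smooth[OF assms(2) that]]
    by simp
qed (use assms in \<open>auto simp: tangent_add vfields_tangent vfields_outside\<close>)

lemma vfields_mult:
  assumes "smooth_fun A U f" "X \<in> vfields A U"
  shows "vf_mult f X \<in> vfields A U"
proof (rule vfieldsI)
  show "vf_mult f X p \<in> tangent_space A p" for p
    using tangent_scale[OF vfields_tangent[OF assms(2)]] by (simp add: vf_mult_def)
  show "vf_mult f X p = 0" if "p \<notin> U" for p
    using vfields_outside[OF assms(2) that] by (simp add: vf_mult_def fun_eq_iff)
  show "smooth_fun A V (\<lambda>p. vf_mult f X p g)" if "open V" "V \<subseteq> U" "smooth_fun A V g" for V g
    using smooth_fun_mult[OF that(1) smooth_fun_subset[OF assms(1) that(2)] vfields_smooth[OF assms(2) that]]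
    by (simp add: vf_mult_def)
qed

lemma vfields_diff:
  assumes "open U" "X \<in> vfields A U" "Y \<in> vfields A U"
  shows "X - Y \<in> vfields A U"
proof -
  have "X - Y = X + vf_mult (\<lambda>_. -1) Y" by (simp add: vf_mult_def fun_eq_iff)
  also have "\<dots> \<in> vfields A U"
    by (intro vfields_add vfields_mult smooth_fun_const assms)
  finally show ?thesis .
qed

lemma vfields_sum: "(\<And>i. i \<in> I \<Longrightarrow> X i \<in> vfields A U) \<Longrightarrow> (\<Sum>i\<in>I. X i) \<in> vfields A U"
  by (induction I rule: infinite_finite_induct) (auto simp: vfields_zero vfields_add)

lemma vfields_restrict:
  assumes "X \<in> vfields A U" "open V" "V \<subseteq> U"
  shows "vf_restrict V X \<in> vfields A V"
proof (rule vfieldsI)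
  fix W f assume W: "open W" "W \<subseteq> V" "smooth_fun A W f"
  have "smooth_fun A W (\<lambda>p. X p f)" using vfields_smooth[OF assms(1) W(1) _ W(3)] W(2) assms(3) by auto
  then show "smooth_fun A W (\<lambda>p. vf_restrict V X p f)"
    by (rule smooth_fun_cong[OF W(1), rotated]) (use W(2) in \<open>auto simp: vf_restrict_apply\<close>)
qed (auto simp: vf_restrict_def vfields_tangent[OF assms(1)])

end

section \<open>Fields of constant length on a Riemannian manifold\<close>

lemma vf_restrict_zero: "vf_restrict U 0 = 0"
  by (simp add: vf_restrict_def fun_eq_iff)

context riemannian_manifold
begin

lemma metric_zero_left: "v \<in> tangent_space A p \<Longrightarrow> h p 0 v = 0"
  using metric_scale[of 0 p v 0] tangent_zero[of p] by (simp add: zero_fun_def)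

lemma metric_uminus_left:
  "u \<in> tangent_space A p \<Longrightarrow> v \<in> tangent_space A p \<Longrightarrow> h p (- u) v = - h p u v"
  using metric_scale[of u p v "-1"] by (simp add: fun_Compl_def)

lemma tangent_uminus: "u \<in> tangent_space A p \<Longrightarrow> - u \<in> tangent_space A p"
  using tangent_scale[of u p "-1"] by (simp add: fun_Compl_def)

lemma metric_diff_left:
  "u \<in> tangent_space A p \<Longrightarrow> v \<in> tangent_space A p \<Longrightarrow> w \<in> tangent_space A p \<Longrightarrow>
    h p (u - v) w = h p u w - h p v w"
  using metric_add[of u p "- v" w] by (simp add: metric_uminus_left tangent_uminus)

lemma tangent_sum: "(\<And>i. i \<in> I \<Longrightarrow> u i \<in> tangent_space A p) \<Longrightarrow> (\<Sum>i\<in>I. u i) \<in> tangent_space A p"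
  by (induction I rule: infinite_finite_induct) (auto simp: tangent_zero tangent_add)

lemma metric_sum_left:
  "(\<And>i. i \<in> I \<Longrightarrow> u i \<in> tangent_space A p) \<Longrightarrow> w \<in> tangent_space A p \<Longrightarrow>
    h p (\<Sum>i\<in>I. u i) w = (\<Sum>i\<in>I. h p (u i) w)"
  by (induction I rule: infinite_finite_induct) (auto simp: metric_zero_left metric_add tangent_sum)

lemma metric_nonneg: "u \<in> tangent_space A p \<Longrightarrow> h p u u \<ge> 0"
  by (cases "u = 0") (auto simp: metric_zero_left less_imp_le metric_pos)

lemma metric_eq_0D: "u \<in> tangent_space A p \<Longrightarrow> h p u u = 0 \<Longrightarrow> u = 0"
  using metric_pos[of u p] by force

lemma chart_form_linear:
  assumes "c \<in> A" "p \<in> fst c"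
  shows "linear (\<lambda>x. h p (dir_deriv A c p x) (dir_deriv A c p y))"
proof -
  have T: "dir_deriv A c p x \<in> tangent_space A p" for x
    using tangent_space_eq[OF assms] by simp
  show ?thesis
    by (rule linearI) (simp_all add: dir_deriv_add[OF assms] dir_deriv_scale[OF assms] metric_add metric_scale T)
qed

text \<open>A chart transports the statement to the form \<open>h p\<close> pulled back to the model space.\<close>

lemma orthonormal_tangent_expansion:
  assumes e: "\<And>i. i < mfd_dim A \<Longrightarrow> e i \<in> tangent_space A p" "orthonormal_family (h p) (mfd_dim A) e"
    and v: "v \<in> tangent_space A p"
  shows "v = (\<lambda>f. \<Sum>i<mfd_dim A. h p v (e i) * e i f)"
proof -
  obtain c where c: "c \<in> A" "p \<in> fst c" by (rule chart_at)
  note T = tangent_space_eq[OF c]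
  obtain x where x: "v = dir_deriv A c p x" using v T by auto
  define w where "w i = inv_into UNIV (dir_deriv A c p) (e i)" for i
  have w: "e i = dir_deriv A c p (w i)" if "i < mfd_dim A" for i
    using e(1)[OF that] unfolding w_def T by (simp add: f_inv_into_f)
  define Q where "Q x y = h p (dir_deriv A c p x) (dir_deriv A c p y)" for x y
  have "orthonormal_family Q (mfd_dim A) w"
    using e(2) w by (simp add: orthonormal_family_def Q_def)
  moreover have "linear (\<lambda>x. Q x y)" for y
    unfolding Q_def using chart_form_linear[OF c] .
  ultimately have "x = (\<Sum>i<mfd_dim A. Q x (w i) *\<^sub>R w i)"
    using orthonormal_expansion[OF finite_dim, of Q w x] by (simp add: mfd_dim_def)
  then have "v = dir_deriv A c p (\<Sum>i<mfd_dim A. Q x (w i) *\<^sub>R w i)" unfolding x by (rule arg_cong)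
  also have "\<dots> = (\<lambda>f. \<Sum>i<mfd_dim A. h p v (e i) * e i f)"
    unfolding dir_deriv_sum[OF c] by (auto simp: Q_def x w intro!: sum.cong)
  finally show ?thesis .
qed

lemma orthonormal_frame_family:
  "orthonormal_frame A h U e \<Longrightarrow> p \<in> U \<Longrightarrow> orthonormal_family (h p) (mfd_dim A) (\<lambda>i. e i p)"
  by (simp add: orthonormal_frame_def orthonormal_family_def)

lemma orthonormal_frame_tangent:
  "orthonormal_frame A h U e \<Longrightarrow> i < mfd_dim A \<Longrightarrow> e i p \<in> tangent_space A p"
  using vfields_tangent by (auto simp: orthonormal_frame_def)

lemma frame_expansion:
  assumes e: "orthonormal_frame A h U e" and X: "X \<in> vfields A U"
  shows "X = (\<Sum>i<mfd_dim A. vf_mult (\<lambda>p. h p (X p) (e i p)) (e i))"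
proof (intro ext)
  fix p f
  have "X p f = (\<Sum>i<mfd_dim A. h p (X p) (e i p) * e i p f)"
  proof (cases "p \<in> U")
    case True
    have "X p = (\<lambda>f. \<Sum>i<mfd_dim A. h p (X p) (e i p) * e i p f)"
      by (rule orthonormal_tangent_expansion[where e="\<lambda>i. e i p"])
        (use orthonormal_frame_family[OF e True] orthonormal_frame_tangent[OF e] vfields_tangent[OF X] in auto)
    then show ?thesis by (rule fun_cong)
  next
    case False
    then show ?thesis
      using vfields_outside[OF X False] e vfields_outside[of _ U p] by (simp add: orthonormal_frame_def)
  qed
  then show "X p f = (\<Sum>i<mfd_dim A. vf_mult (\<lambda>p. h p (X p) (e i p)) (e i)) p f"
    by (simp add: sum_fun_apply vf_mult_def)
qed

lemma tangent_eq_0_if_orthogonal_to_frame: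
  assumes "orthonormal_frame A h U e" "p \<in> U" "v \<in> tangent_space A p"
    "\<And>i. i < mfd_dim A \<Longrightarrow> h p v (e i p) = 0"
  shows "v = 0"
proof -
  have "v = (\<lambda>f. \<Sum>i<mfd_dim A. h p v (e i p) * e i p f)"
    by (rule orthonormal_tangent_expansion[where e="\<lambda>i. e i p"])
      (use orthonormal_frame_family[OF assms(1,2)] orthonormal_frame_tangent[OF assms(1)] assms(3) in auto)
  also have "\<dots> = 0" using assms(4) by (simp add: fun_eq_iff)
  finally show ?thesis .
qed

lemma orthonormal_frame_restrict:
  assumes "orthonormal_frame A h U e" "open V" "V \<subseteq> U"
  shows "orthonormal_frame A h V (\<lambda>i. vf_restrict V (e i))"
  using assms vfields_restrict by (auto simp: orthonormal_frame_def vf_restrict_apply subset_iff)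

end

context affine_connection
begin

lemma nabla_zero_left: "open U \<Longrightarrow> Y \<in> vfields A U \<Longrightarrow> nabla U 0 Y = 0"
  using nabla_add_left[of U 0 0 Y] vfields_zero by simp

lemma nabla_zero_right: "open U \<Longrightarrow> X \<in> vfields A U \<Longrightarrow> nabla U X 0 = 0"
  using nabla_add_right[of U X 0 0] vfields_zero by simp

lemma nabla_sum_left:
  "open U \<Longrightarrow> (\<And>i. i \<in> I \<Longrightarrow> X i \<in> vfields A U) \<Longrightarrow> Y \<in> vfields A U \<Longrightarrow>
    nabla U (\<Sum>i\<in>I. X i) Y = (\<Sum>i\<in>I. nabla U (X i) Y)"
  by (induction I rule: infinite_finite_induct) (auto simp: nabla_zero_left nabla_add_left vfields_sum)

end

context levi_civita_connection
begin

text \<open>Tensoriality in the direction argument, at a single point. The coefficients of \<open>X\<close> in the frame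
  are smooth on all of \<open>U\<close>, so the connection is linear over them and the values \<open>\<nabla>\<^sub>e\<^sub>i Z\<close> at \<open>p\<close> determine the result.\<close>

lemma nabla_eq_0_from_frame:
  assumes e: "orthonormal_frame A h U e" and X: "X \<in> vfields A U" and Z: "Z \<in> vfields A U"
    and 0: "\<And>i. i < mfd_dim A \<Longrightarrow> nabla U (e i) Z p = 0"
  shows "nabla U X Z p = 0"
proof -
  let ?g = "\<lambda>i p. h p (X p) (e i p)"
  have U: "open U" and ei: "\<And>i. i < mfd_dim A \<Longrightarrow> e i \<in> vfields A U"
    using e by (auto simp: orthonormal_frame_def)
  have g: "smooth_fun A U (?g i)" if "i < mfd_dim A" for i
    using metric_smooth[OF U X ei[OF that]] .
  have "nabla U X Z = nabla U (\<Sum>i<mfd_dim A. vf_mult (?g i) (e i)) Z"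
    by (rule arg_cong[OF frame_expansion[OF e X]])
  also have "\<dots> = (\<Sum>i<mfd_dim A. nabla U (vf_mult (?g i) (e i)) Z)"
    by (rule nabla_sum_left[OF U _ Z]) (simp add: vfields_mult g ei)
  also have "\<dots> = (\<Sum>i<mfd_dim A. vf_mult (?g i) (nabla U (e i) Z))"
    by (rule sum.cong) (simp_all add: nabla_mult_left U g ei Z)
  finally show ?thesis using 0 by (simp add: sum_fun_apply vf_mult_def fun_eq_iff)
qed

lemma nabla_constant_length:
  assumes U: "open U" and X: "X \<in> vfields A U" and Z: "Z \<in> vfields A U" and p: "p \<in> U"
    and const: "\<And>q. q \<in> U \<Longrightarrow> h q (Z q) (Z q) = r"
  shows "h p (nabla U X Z p) (Z p) = 0"
proof -
  have T: "nabla U X Z p \<in> tangent_space A p" "Z p \<in> tangent_space A p"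
    using vfields_tangent[OF nabla_closed[OF U X Z]] vfields_tangent[OF Z] by auto
  have "X p (\<lambda>q. h q (Z q) (Z q)) = 0"
    using tangent_locally_const[OF vfields_tangent[OF X] U p const] .
  then show ?thesis
    using metric_compatible[OF U X Z Z p] metric_sym[OF T] by simp
qed

text \<open>Since \<open>\<nabla>\<^sub>X Z\<close> is orthogonal to \<open>Z\<close> on all of \<open>U\<close>, differentiating \<open>\<langle>\<nabla>\<^sub>e Z, Z\<rangle> = 0\<close> along \<open>e = e\<^sub>i\<close> gives
  \<open>\<langle>\<nabla>\<^sub>e \<nabla>\<^sub>e Z, Z\<rangle> = - \<langle>\<nabla>\<^sub>e Z, \<nabla>\<^sub>e Z\<rangle>\<close>, while the correction term \<open>\<nabla> Z\<close> in direction \<open>\<nabla>\<^sub>e e\<close> contributes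
  nothing, by the same orthogonality.\<close>

lemma bochner_constant_length:
  assumes e: "orthonormal_frame A h U e" and p: "p \<in> U"
    and xi: "\<xi> \<in> vfields A UNIV" and const: "\<And>q. h q (\<xi> q) (\<xi> q) = r"
  shows "h p (frame_laplacian A nabla U e \<xi> p) (\<xi> p) =
    (\<Sum>i<mfd_dim A. h p (nabla U (e i) (vf_restrict U \<xi>) p) (nabla U (e i) (vf_restrict U \<xi>) p))"
proof -
  define Z where "Z = vf_restrict U \<xi>"
  have U: "open U" and ei: "\<And>i. i < mfd_dim A \<Longrightarrow> e i \<in> vfields A U"
    using e by (auto simp: orthonormal_frame_def)
  have Z: "Z \<in> vfields A U" unfolding Z_def using vfields_restrict[OF xi U] by simp
  have Zp: "\<xi> p = Z p" using p by (simp add: Z_def vf_restrict_apply)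
  have len: "h q (Z q) (Z q) = r" if "q \<in> U" for q
    using that const by (simp add: Z_def vf_restrict_apply)
  have perp: "h q (nabla U X Z q) (Z q) = 0" if "q \<in> U" "X \<in> vfields A U" for q X
    using nabla_constant_length[OF U that(2) Z that(1) len] .
  have term_eq: "h p ((nabla U (e i) (nabla U (e i) Z) - nabla U (nabla U (e i) (e i)) Z) p) (Z p)
      = - h p (nabla U (e i) Z p) (nabla U (e i) Z p)" if i: "i < mfd_dim A" for i
  proof -
    have Y: "nabla U (e i) Z \<in> vfields A U" and W: "nabla U (e i) (e i) \<in> vfields A U"
      using nabla_closed U ei[OF i] Z by auto
    have YY: "nabla U (e i) (nabla U (e i) Z) \<in> vfields A U" "nabla U (nabla U (e i) (e i)) Z \<in> vfields A U"
      using nabla_closed U ei[OF i] Z Y W by auto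
    have "0 = e i p (\<lambda>q. h q (nabla U (e i) Z q) (Z q))"
      using tangent_locally_const[OF vfields_tangent[OF ei[OF i]] U p perp[OF _ ei[OF i]]] by simp
    also have "\<dots> = h p (nabla U (e i) (nabla U (e i) Z) p) (Z p) + h p (nabla U (e i) Z p) (nabla U (e i) Z p)"
      using metric_compatible[OF U ei[OF i] Y Z p] .
    finally show ?thesis
      using perp[OF p W] metric_diff_left[OF YY(1,2)[THEN vfields_tangent] vfields_tangent[OF Z], of p] by simp
  qed
  let ?D = "\<lambda>i. (nabla U (e i) (nabla U (e i) Z) - nabla U (nabla U (e i) (e i)) Z) p"
  have D: "?D i \<in> tangent_space A p" if "i < mfd_dim A" for i
    by (rule vfields_tangent[OF vfields_diff[OF U]]) (intro nabla_closed U ei that Z)+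
  have "h p (frame_laplacian A nabla U e \<xi> p) (\<xi> p) = h p (- (\<Sum>i<mfd_dim A. ?D i)) (Z p)"
    unfolding frame_laplacian_def Zp Z_def[symmetric] by (simp only: uminus_apply sum_fun_apply)
  also have "\<dots> = - h p (\<Sum>i<mfd_dim A. ?D i) (Z p)"
    by (rule metric_uminus_left[OF tangent_sum vfields_tangent[OF Z]]) (rule D, simp)
  also have "h p (\<Sum>i<mfd_dim A. ?D i) (Z p) = (\<Sum>i<mfd_dim A. h p (?D i) (Z p))"
    by (rule metric_sum_left[OF _ vfields_tangent[OF Z]]) (rule D, simp)
  also have "- (\<Sum>i<mfd_dim A. h p (?D i) (Z p)) = (\<Sum>i<mfd_dim A. h p (nabla U (e i) Z p) (nabla U (e i) Z p))"
    using term_eq by (simp add: sum_negf)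
  finally show ?thesis unfolding Z_def .
qed

text \<open>The inner product of \<open>\<Delta>\<xi>\<close> with \<open>\<xi>\<close> is the squared length of \<open>\<nabla>\<xi>\<close>. The global frame
  serves two purposes: it guarantees that the choice of a local frame in the
  definition of the Laplacian succeeds, and, for the converse, it expresses every local field
  through restrictions of global ones, along which \<open>\<xi>\<close> is known to be parallel.\<close>

theorem harmonic_constant_length_iff_parallel:
  assumes E: "orthonormal_frame A h UNIV E"
    and xi: "\<xi> \<in> vfields A UNIV" and const: "\<And>q. h q (\<xi> q) (\<xi> q) = r"
  shows "harmonic A h nabla \<xi> \<longleftrightarrow> (\<forall>X\<in>vfields A UNIV. nabla UNIV X \<xi> = 0)"
proof -
  have frame: "\<exists>U e. p \<in> U \<and> orthonormal_frame A h U e \<and>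
      vf_laplacian A h nabla \<xi> p = frame_laplacian A nabla U e \<xi> p" for p
  proof -
    let ?P = "\<lambda>(U, e). p \<in> U \<and> orthonormal_frame A h U e"
    obtain U e where Ue: "(SOME x. ?P x) = (U, e)" by (cases "SOME x. ?P x")
    have "?P (SOME x. ?P x)" by (rule someI[of ?P "(UNIV, E)"]) (simp add: E)
    then show ?thesis unfolding vf_laplacian_def Ue by auto
  qed
  show ?thesis
  proof
    assume harm: "harmonic A h nabla \<xi>"
    show "\<forall>X\<in>vfields A UNIV. nabla UNIV X \<xi> = 0"
    proof (intro ballI ext)
      fix X p f assume X: "X \<in> vfields A UNIV"
      obtain U e where p: "p \<in> U" and e: "orthonormal_frame A h U e"
        and "frame_laplacian A nabla U e \<xi> p = 0"
        using frame[of p] harm unfolding harmonic_def by (metis zero_fun_apply)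
      then have sum0: "(\<Sum>i<mfd_dim A. h p (nabla U (e i) (vf_restrict U \<xi>) p) (nabla U (e i) (vf_restrict U \<xi>) p)) = 0"
        using bochner_constant_length[OF e p xi const] metric_zero_left[OF vfields_tangent[OF xi]] by simp
      have U: "open U" and ei: "\<And>i. i < mfd_dim A \<Longrightarrow> e i \<in> vfields A U"
        using e by (auto simp: orthonormal_frame_def)
      have XU: "vf_restrict U X \<in> vfields A U" and Z: "vf_restrict U \<xi> \<in> vfields A U"
        using vfields_restrict U X xi by auto
      have T: "nabla U (e i) (vf_restrict U \<xi>) p \<in> tangent_space A p" if "i < mfd_dim A" for i
        using nabla_closed[OF U ei[OF that] Z] vfields_tangent by blast
      have "nabla U (e i) (vf_restrict U \<xi>) p = 0" if i: "i < mfd_dim A" for i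
      proof -
        have "h p (nabla U (e i) (vf_restrict U \<xi>) p) (nabla U (e i) (vf_restrict U \<xi>) p) = 0"
          using sum_nonneg_0[OF finite_lessThan _ sum0, of i] T metric_nonneg i by auto
        then show ?thesis using metric_eq_0D[OF T[OF i]] by simp
      qed
      then have "nabla U (vf_restrict U X) (vf_restrict U \<xi>) p = 0"
        using nabla_eq_0_from_frame[OF e XU Z] by blast
      moreover have "nabla UNIV X \<xi> p = vf_restrict U (nabla UNIV X \<xi>) p"
        using p by (simp add: vf_restrict_apply)
      ultimately show "nabla UNIV X \<xi> p f = 0 p f"
        using nabla_restrict[OF open_UNIV U _ X xi] by simp
    qed
  next
    assume par: "\<forall>X\<in>vfields A UNIV. nabla UNIV X \<xi> = 0"
    have "vf_laplacian A h nabla \<xi> p = 0" for p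
    proof -
      obtain U e where p: "p \<in> U" and e: "orthonormal_frame A h U e"
        and lap: "vf_laplacian A h nabla \<xi> p = frame_laplacian A nabla U e \<xi> p"
        using frame[of p] by blast
      have U: "open U" and ei: "\<And>i. i < mfd_dim A \<Longrightarrow> e i \<in> vfields A U"
        using e by (auto simp: orthonormal_frame_def)
      have Ei: "E i \<in> vfields A UNIV" if "i < mfd_dim A" for i
        using E that by (auto simp: orthonormal_frame_def)
      have Z: "vf_restrict U \<xi> \<in> vfields A U"
        using vfields_restrict U xi by auto
      (* The members of the local frame need not extend to global fields, so the hypothesis on
         global fields reaches them only through the restrictions of E. *)
      have "nabla U (vf_restrict U (E i)) (vf_restrict U \<xi>) = 0" if "i < mfd_dim A" for i
      proof -
        have "nabla UNIV (E i) \<xi> = 0" using par Ei[OF that] by blast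
        then show ?thesis
          using nabla_restrict[OF open_UNIV U _ Ei[OF that] xi] vf_restrict_zero[of U] by simp
      qed
      then have 0: "nabla U Y (vf_restrict U \<xi>) = 0" if "Y \<in> vfields A U" for Y
        using nabla_eq_0_from_frame[OF orthonormal_frame_restrict[OF E U] that Z]
        by (intro ext) auto
      show ?thesis
        unfolding lap frame_laplacian_def
        using 0 ei nabla_closed[OF U] nabla_zero_right[OF U] by (simp add: sum_fun_apply)
    qed
    then show "harmonic A h nabla \<xi>" unfolding harmonic_def by (intro ext) auto
  qed
qed

end

section \<open>Left-invariant vector fields\<close>

lemma left_push_mult:
  assumes "group G" "carrier G = UNIV"
  shows "left_push G (a \<otimes>\<^bsub>G\<^esub> b) v = left_push G a (left_push G b v)"
  using group.is_monoid[OF assms(1)] monoid.m_assoc[of G] assms(2) by (simp add: left_push_def)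

context lie_group
begin

lemma left_cancel [simp]: "inv a \<otimes> (a \<otimes> p) = p" "a \<otimes> (inv a \<otimes> p) = p"
  using m_assoc[of "inv a" a p] m_assoc[of a "inv a" p] by (simp_all add: carrier_UNIV)

lemma one_mult [simp]: "\<one> \<otimes> p = p" "p \<otimes> \<one> = p"
  by (simp_all add: carrier_UNIV)

lemma continuous_mult: "continuous_on UNIV (\<lambda>(x, y). x \<otimes> y)"
  using mult_smooth by (simp add: smooth_map_def)

text \<open>The part of a coordinate box on which the product of the two points lies in \<open>V\<close>. All smoothness
  statements about translations come from multiplication as a function on such sets.\<close>

definition mult_domain :: "('g, 'e) chart \<Rightarrow> ('g, 'e) chart \<Rightarrow> 'g set \<Rightarrow> ('e \<times> 'e) set"
  where "mult_domain c d V =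
    {z. fst z \<in> snd c ` fst c \<and> snd z \<in> snd d ` fst d \<and> chart_inv c (fst z) \<otimes> chart_inv d (snd z) \<in> V}"

lemma mult_domainI:
  assumes "c \<in> A" "d \<in> A" "p \<in> fst c" "q \<in> fst d" "p \<otimes> q \<in> V"
  shows "(snd c p, snd d q) \<in> mult_domain c d V"
  using assms by (simp add: mult_domain_def chart_left)

lemma open_mult_domain:
  assumes c: "c \<in> A" and d: "d \<in> A" and V: "open V"
  shows "open (mult_domain c d V)"
proof -
  let ?D = "(snd c ` fst c) \<times> (snd d ` fst d)"
  let ?m = "\<lambda>z. chart_inv c (fst z) \<otimes> chart_inv d (snd z)"
  have inv_cont: "continuous_on (snd k ` fst k) (chart_inv k)" if "k \<in> A" for k
    using chart_homeo[OF that] by (simp add: homeomorphism_def)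
  have "continuous_on ?D (\<lambda>z. (chart_inv c (fst z), chart_inv d (snd z)))"
    by (intro continuous_on_Pair continuous_on_compose2[OF inv_cont[OF c]]
        continuous_on_compose2[OF inv_cont[OF d]] continuous_intros) auto
  then have "continuous_on ?D ?m"
    using continuous_on_compose2[OF continuous_mult, of ?D] by fastforce
  moreover have "open ?D" using chart_open c d by (intro open_Times) auto
  ultimately have "open (?D \<inter> ?m -` V)" using continuous_open_preimage V by blast
  moreover have "?D \<inter> ?m -` V = mult_domain c d V" by (auto simp: mult_domain_def)
  ultimately show ?thesis by simp
qed

lemma smooth_on_mult_charts:
  assumes c: "c \<in> A" and d: "d \<in> A" and k: "k \<in> A"
  shows "smooth_on (mult_domain c d (fst k)) (\<lambda>z. snd k (chart_inv c (fst z) \<otimes> chart_inv d (snd z)))"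
proof -
  let ?P = "(fst c \<times> fst d, map_prod (snd c) (snd d))"
  have inj: "inj_on (map_prod (snd c) (snd d)) (fst c \<times> fst d)"
    by (rule inj_on_inverseI[where g="map_prod (chart_inv c) (chart_inv d)"])
      (auto simp: chart_left c d)
  have inv: "inv_into (fst c \<times> fst d) (map_prod (snd c) (snd d)) (snd c p, snd d q) = (p, q)"
    if "p \<in> fst c" "q \<in> fst d" for p q
    using inv_into_f_f[OF inj, of "(p, q)"] that by simp
  have "?P \<in> prod_atlas A A"
    using c d unfolding prod_atlas_def by (intro CollectI exI[of _ "fst c"] exI[of _ "snd c"]
        exI[of _ "fst d"] exI[of _ "snd d"]) simp
  then have sm: "smooth_on (snd ?P ` (fst ?P \<inter> (\<lambda>(x, y). x \<otimes> y) -` fst k))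
      (snd k \<circ> (\<lambda>(x, y). x \<otimes> y) \<circ> chart_inv ?P)"
    using mult_smooth k unfolding smooth_map_def by blast
  have set_eq: "snd ?P ` (fst ?P \<inter> (\<lambda>(x, y). x \<otimes> y) -` fst k) = mult_domain c d (fst k)"
  proof (intro equalityI subsetI)
    fix z assume "z \<in> snd ?P ` (fst ?P \<inter> (\<lambda>(x, y). x \<otimes> y) -` fst k)"
    then show "z \<in> mult_domain c d (fst k)" by (auto simp: mult_domain_def chart_left c d)
  next
    fix z assume z: "z \<in> mult_domain c d (fst k)"
    then have "z = map_prod (snd c) (snd d) (chart_inv c (fst z), chart_inv d (snd z))"
      by (simp add: mult_domain_def chart_right c d)
    then show "z \<in> snd ?P ` (fst ?P \<inter> (\<lambda>(x, y). x \<otimes> y) -` fst k)"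
      using z by (intro image_eqI[of _ _ "(chart_inv c (fst z), chart_inv d (snd z))"])
        (simp_all add: mult_domain_def chart_right(2)[OF c] chart_right(2)[OF d])
  qed
  have "open (mult_domain c d (fst k))"
    using open_mult_domain[OF c d] chart_open[OF k] by blast
  then show ?thesis
    by (rule smooth_on_cong[OF _ _ sm[unfolded set_eq]]) (auto simp: mult_domain_def inv chart_left c d)
qed

lemma smooth_on_comp_mult:
  assumes c: "c \<in> A" and d: "d \<in> A" and V: "open V" and f: "smooth_fun A V f"
  shows "smooth_on (mult_domain c d V) (\<lambda>z. f (chart_inv c (fst z) \<otimes> chart_inv d (snd z)))"
proof (rule smooth_on_local)
  fix z assume z: "z \<in> mult_domain c d V"
  obtain k where k: "k \<in> A" "chart_inv c (fst z) \<otimes> chart_inv d (snd z) \<in> fst k" by (rule chart_at)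
  let ?T = "mult_domain c d (V \<inter> fst k)"
  let ?m = "\<lambda>z. snd k (chart_inv c (fst z) \<otimes> chart_inv d (snd z))"
  have T: "open ?T" using open_mult_domain[OF c d] V chart_open[OF k(1)] by blast
  have zT: "z \<in> ?T" using z k(2) by (simp add: mult_domain_def)
  have m: "smooth_on ?T ?m"
    using smooth_on_mult_charts[OF c d k(1)] by (rule smooth_on_subset) (auto simp: mult_domain_def)
  have mV: "?m y \<in> snd k ` (fst k \<inter> V)" if "y \<in> ?T" for y
    using that by (auto simp: mult_domain_def)
  have fk: "smooth_on (snd k ` (fst k \<inter> V)) (f \<circ> chart_inv k)"
    using f k(1) by (simp add: smooth_fun_def)
  have "smooth_on ?T (\<lambda>y. (f \<circ> chart_inv k) (?m y))"
    by (rule smooth_on_compose[OF finite_dim T mV m fk])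
  then have "smooth_on ?T (\<lambda>z. f (chart_inv c (fst z) \<otimes> chart_inv d (snd z)))"
    by (rule smooth_on_cong[OF T, rotated]) (simp add: mult_domain_def chart_left[OF k(1)])
  then show "\<exists>T. open T \<and> z \<in> T \<and> smooth_on T (\<lambda>z. f (chart_inv c (fst z) \<otimes> chart_inv d (snd z)))"
    using T zT by (intro exI[of _ ?T] conjI)
qed

lemma bounded_linear_Pair_0: "bounded_linear (\<lambda>y. (0, y))" "bounded_linear (\<lambda>x. (x, 0))"
  by (intro bounded_linear_Pair bounded_linear_zero bounded_linear_ident)+

lemma open_left_translate:
  assumes "open V"
  shows "open {q. a \<otimes> q \<in> V}"
proof -
  have "continuous_on UNIV (\<lambda>q. a \<otimes> q)"
    using continuous_on_compose2[OF continuous_mult, of UNIV "\<lambda>q. (a, q)"]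
    by (simp add: continuous_on_Pair)
  then show ?thesis using open_vimage[OF assms, of "\<lambda>q. a \<otimes> q"] by (simp add: vimage_def)
qed

lemma smooth_fun_left_translate:
  assumes V: "open V" and f: "smooth_fun A V f"
  shows "smooth_fun A {q. a \<otimes> q \<in> V} (\<lambda>q. f (a \<otimes> q))"
proof (rule smooth_fun_chartsI)
  fix p assume p: "p \<in> {q. a \<otimes> q \<in> V}"
  obtain c where c: "c \<in> A" "a \<in> fst c" by (rule chart_at)
  obtain d where d: "d \<in> A" "p \<in> fst d" by (rule chart_at)
  let ?W = "fst d \<inter> {q. a \<otimes> q \<in> V}"
  have W: "open ?W" using chart_open[OF d(1)] open_left_translate[OF V] by blast
  have oW: "open (snd d ` ?W)" by (rule chart_preimage_open[OF d(1) open_left_translate[OF V]])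
  have in_dom: "(0, y) + (snd c a, 0) \<in> mult_domain c d V" if "y \<in> snd d ` ?W" for y
    using that mult_domainI[OF c(1) d(1) c(2)] by auto
  have "smooth_on (snd d ` ?W) (\<lambda>y. (\<lambda>z. f (chart_inv c (fst z) \<otimes> chart_inv d (snd z))) ((0, y) + (snd c a, 0)))"
    by (rule smooth_on_compose_affine[OF oW bounded_linear_Pair_0(1) in_dom smooth_on_comp_mult[OF c(1) d(1) V f]])
  then have "smooth_on (snd d ` ?W) ((\<lambda>q. f (a \<otimes> q)) \<circ> chart_inv d)"
    by (simp add: chart_left[OF c] comp_def)
  then show "\<exists>d\<in>A. \<exists>W. open W \<and> p \<in> W \<and> W \<subseteq> fst d \<and> smooth_on (snd d ` W) ((\<lambda>q. f (a \<otimes> q)) \<circ> chart_inv d)"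
    using d W p by (intro bexI[of _ d] exI[of _ ?W]) auto
qed

text \<open>One implication suffices: translating back by \<open>inv a\<close> gives the other. The equivalence is needed
  because tangent vectors are set to \<open>0\<close> on functions that are not smooth near the point.\<close>

lemma smooth_near_left_translate: "smooth_near A p (\<lambda>q. f (a \<otimes> q)) \<longleftrightarrow> smooth_near A (a \<otimes> p) f"
proof -
  have imp: "smooth_near A r (\<lambda>q. g (b \<otimes> q))" if sn: "smooth_near A (b \<otimes> r) g" for b r g
  proof -
    obtain V where V: "open V" "b \<otimes> r \<in> V" "smooth_fun A V g"
      using sn unfolding smooth_near_def by blast
    show ?thesis
      by (rule smooth_nearI[OF open_left_translate[OF V(1)] _ smooth_fun_left_translate[OF V(1,3)]])
        (use V(2) in simp)
  qed
  show ?thesis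
    using imp[of a p f] imp[of "inv a" "a \<otimes> p" "\<lambda>q. f (a \<otimes> q)"] by auto
qed

lemma left_push_tangent:
  assumes "v \<in> tangent_space A p"
  shows "left_push G a v \<in> tangent_space A (a \<otimes> p)"
proof -
  obtain k where k: "k \<in> A" "a \<in> fst k" by (rule chart_at)
  obtain c where c: "c \<in> A" "p \<in> fst c" by (rule chart_at)
  obtain d where d: "d \<in> A" "a \<otimes> p \<in> fst d" by (rule chart_at)
  obtain w where w: "v = dir_deriv A c p w" using assms tangent_space_eq[OF c] by auto
  define t where "t = (\<lambda>y. snd d (a \<otimes> chart_inv c y))"
  let ?W = "fst c \<inter> {q. a \<otimes> q \<in> fst d}"
  have oW: "open (snd c ` ?W)"
    using chart_preimage_open[OF c(1) open_left_translate] chart_open[OF d(1)] by blast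
  have in_dom: "(0, y) + (snd k a, 0) \<in> mult_domain k c (fst d)" if "y \<in> snd c ` ?W" for y
    using that mult_domainI[OF k(1) c(1) k(2)] by auto
  have "smooth_on (snd c ` ?W) (\<lambda>y. (\<lambda>z. snd d (chart_inv k (fst z) \<otimes> chart_inv c (snd z))) ((0, y) + (snd k a, 0)))"
    by (rule smooth_on_compose_affine[OF oW bounded_linear_Pair_0(1) in_dom smooth_on_mult_charts[OF k(1) c(1) d(1)]])
  then have t: "smooth_on (snd c ` ?W) t"
    by (simp add: chart_left[OF k] t_def)
  have pW: "snd c p \<in> snd c ` ?W" using c d by blast
  have Dt: "(t has_derivative frechet_derivative t (at (snd c p))) (at (snd c p))"
    by (rule smooth_on_has_derivative[OF t pW])
  have "left_push G a v = dir_deriv A d (a \<otimes> p) (frechet_derivative t (at (snd c p)) w)"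
  proof
    fix f
    show "left_push G a v f = dir_deriv A d (a \<otimes> p) (frechet_derivative t (at (snd c p)) w) f"
    proof (cases "smooth_near A (a \<otimes> p) f")
      case True
      have "((f \<circ> chart_inv d) has_derivative frechet_derivative (f \<circ> chart_inv d) (at (snd d (a \<otimes> p)))) (at (t (snd c p)))"
        using smooth_near_has_derivative[OF True d] by (simp add: t_def chart_left[OF c])
      from has_derivative_compose[OF Dt this]
      have "(((\<lambda>q. f (a \<otimes> q)) \<circ> chart_inv c) has_derivative
          (\<lambda>v. frechet_derivative (f \<circ> chart_inv d) (at (snd d (a \<otimes> p))) (frechet_derivative t (at (snd c p)) v))) (at (snd c p))"
        by (rule has_derivative_transform_within_open[OF _ oW pW])
          (auto simp: t_def chart_left[OF c(1)] chart_left[OF d(1)])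
      then show ?thesis
        using True by (simp add: left_push_def w dir_deriv_def smooth_near_left_translate frechet_derivative_at[symmetric])
    next
      case False
      then show ?thesis
        by (simp add: left_push_def w dir_deriv_def smooth_near_left_translate)
    qed
  qed
  then show ?thesis using tangent_space_eq[OF d] by simp
qed

text \<open>In charts, the field applied to \<open>f\<close> at the point with coordinates \<open>x\<close> is the partial derivative of
  \<open>F(x, y) = f(x \<cdot> y)\<close> in the second variable, in a fixed direction and at the fixed point \<open>y = \<one>\<close>. It
  depends smoothly on \<open>x\<close> because \<open>F\<close> is jointly smooth.\<close>

lemma left_invariant_extension:
  assumes v: "v \<in> tangent_space A \<one>"
  shows "(\<lambda>a. left_push G a v) \<in> lie_algebra G A"
proof -
  have "(\<lambda>a. left_push G a v) \<in> vfields A UNIV"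
  proof (rule vfieldsI)
    show "left_push G a v \<in> tangent_space A a" for a
      using left_push_tangent[OF v, of a] by simp
  next
    fix V f assume V: "open V" and f: "smooth_fun A V f"
    obtain c where c: "c \<in> A" "\<one> \<in> fst c" by (rule chart_at)
    obtain w where w: "v = dir_deriv A c \<one> w" using v tangent_space_eq[OF c] by auto
    show "smooth_fun A V (\<lambda>a. left_push G a v f)"
    proof (rule smooth_fun_chartsI)
      fix p assume p: "p \<in> V"
      obtain d where d: "d \<in> A" "p \<in> fst d" by (rule chart_at)
      let ?W = "fst d \<inter> V"
      let ?F = "\<lambda>z. f (chart_inv d (fst z) \<otimes> chart_inv c (snd z))"
      have W: "open ?W" using chart_open[OF d(1)] V by blast
      have oW: "open (snd d ` ?W)" by (rule chart_preimage_open[OF d(1) V])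
      have F: "smooth_on (mult_domain d c V) ?F" by (rule smooth_on_comp_mult[OF d(1) c(1) V f])
      have in_dom: "(x, 0) + (0, snd c \<one>) \<in> mult_domain d c V" if "x \<in> snd d ` ?W" for x
        using that mult_domainI[OF d(1) c(1) _ c(2)] by auto
      have "smooth_on (snd d ` ?W) (\<lambda>x. (\<lambda>z. frechet_derivative ?F (at z) (0, w)) ((x, 0) + (0, snd c \<one>)))"
        using smooth_on_compose_affine[OF oW bounded_linear_Pair_0(2) in_dom smooth_on_frechet_derivative[OF F]] .
      then have "smooth_on (snd d ` ?W) ((\<lambda>a. left_push G a v f) \<circ> chart_inv d)"
      proof (rule smooth_on_cong[OF oW, rotated])
        fix x assume x: "x \<in> snd d ` ?W"
        define a where "a = chart_inv d x"
        have a: "a \<in> V" using x chart_left[OF d(1)] by (auto simp: a_def)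
        have "((\<lambda>y. (0, y) + (x, 0)) has_derivative (\<lambda>y. (0, y))) (at (snd c \<one>))"
          by (intro has_derivative_add_const bounded_linear_imp_has_derivative bounded_linear_Pair_0)
        moreover have "(?F has_derivative frechet_derivative ?F (at (x, snd c \<one>))) (at ((0, snd c \<one>) + (x, 0)))"
          using smooth_on_has_derivative[OF F in_dom[OF x]] by simp
        ultimately have "((\<lambda>y. ?F ((0, y) + (x, 0))) has_derivative
            (\<lambda>y. frechet_derivative ?F (at (x, snd c \<one>)) (0, y))) (at (snd c \<one>))"
          by (rule has_derivative_compose)
        then have "(((\<lambda>q. f (a \<otimes> q)) \<circ> chart_inv c) has_derivative
            (\<lambda>y. frechet_derivative ?F (at (x, snd c \<one>)) (0, y))) (at (snd c \<one>))"
          by (simp add: a_def comp_def)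
        moreover have "smooth_near A \<one> (\<lambda>q. f (a \<otimes> q))"
          using smooth_near_left_translate[of "\<one>" f a] smooth_nearI[OF V a f] by simp
        ultimately have "left_push G a v f = frechet_derivative ?F (at (x, snd c \<one>)) (0, w)"
          by (simp add: left_push_def w dir_deriv_def frechet_derivative_at[symmetric])
        then show "frechet_derivative ?F (at ((x, 0) + (0, snd c \<one>))) (0, w) = ((\<lambda>a. left_push G a v f) \<circ> chart_inv d) x"
          by (simp add: a_def)
      qed
      then show "\<exists>d\<in>A. \<exists>W. open W \<and> p \<in> W \<and> W \<subseteq> fst d \<and> smooth_on (snd d ` W) ((\<lambda>a. left_push G a v f) \<circ> chart_inv d)"
        using d W p by (intro bexI[of _ d] exI[of _ ?W]) auto
    qed
  qed auto
  then show ?thesis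
    using left_push_mult[OF is_group carrier_UNIV] by (simp add: lie_algebra_def)
qed

lemma lie_algebra_vfields: "X \<in> lie_algebra G A \<Longrightarrow> X \<in> vfields A UNIV"
  by (simp add: lie_algebra_def)

lemma lie_algebra_tangent: "X \<in> lie_algebra G A \<Longrightarrow> X p \<in> tangent_space A p"
  using vfields_tangent lie_algebra_vfields by blast

lemma lie_algebra_left_invariant: "X \<in> lie_algebra G A \<Longrightarrow> X (a \<otimes> p) = left_push G a (X p)"
  by (simp add: lie_algebra_def)

lemma lie_bracket_left_invariant:
  assumes "X \<in> lie_algebra G A" "Y \<in> lie_algebra G A"
  shows "lie_bracket A X Y (a \<otimes> p) = left_push G a (lie_bracket A X Y p)"
proof
  fix f
  have inv: "Z (a \<otimes> q) g = Z q (\<lambda>r. g (a \<otimes> r))" if "Z \<in> lie_algebra G A" for Z q g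
    using lie_algebra_left_invariant[OF that] by (simp add: left_push_def)
  show "lie_bracket A X Y (a \<otimes> p) f = left_push G a (lie_bracket A X Y p) f"
    by (simp add: lie_bracket_def left_push_def vf_apply_def smooth_near_left_translate
        inv[OF assms(1)] inv[OF assms(2)])
qed

end

section \<open>Parallel left-invariant fields\<close>

locale left_invariant_levi_civita = left_invariant_metric G A h + levi_civita_connection A h nabla
  for G :: "'g::{t2_space,second_countable_topology} monoid" (structure)
    and A :: "('g, 'e::real_inner) chart set"
    and h :: "'g \<Rightarrow> 'g tangent \<Rightarrow> 'g tangent \<Rightarrow> real"
    and nabla :: "'g set \<Rightarrow> 'g vfield \<Rightarrow> 'g vfield \<Rightarrow> 'g vfield"
begin

text \<open>Inner products of left-invariant fields are constant functions. Hence every derivative of them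
  vanishes, left-invariant fields have constant length, and pointwise identities can be checked in
  the Lie algebra.\<close>

lemma metric_lie_algebra:
  assumes "X \<in> lie_algebra G A" "Y \<in> lie_algebra G A"
  shows "h p (X p) (Y p) = lie_inner G h X Y"
  using metric_left_invariant[OF lie_algebra_tangent[OF assms(1)] lie_algebra_tangent[OF assms(2)], of p "\<one>"]
    lie_algebra_left_invariant[OF assms(1), of p "\<one>"] lie_algebra_left_invariant[OF assms(2), of p "\<one>"]
  by (simp add: lie_inner_def)

lemma lie_inner_eq_0D:
  assumes "X \<in> lie_algebra G A" "lie_inner G h X X = 0"
  shows "X = 0"
  using metric_eq_0D[OF lie_algebra_tangent[OF assms(1)]] metric_lie_algebra[OF assms(1,1)] assms(2)
  by (intro ext) simp

lemma lie_bracket_eq_nabla: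
  assumes "X \<in> lie_algebra G A" "Y \<in> lie_algebra G A"
  shows "lie_bracket A X Y = nabla UNIV X Y - nabla UNIV Y X"
  using torsion_free[OF open_UNIV] assms lie_algebra_vfields by simp

text \<open>Smoothness and tangency of the bracket are inherited from the connection, which is torsion-free.\<close>

lemma lie_bracket_closed:
  assumes "X \<in> lie_algebra G A" "Y \<in> lie_algebra G A"
  shows "lie_bracket A X Y \<in> lie_algebra G A"
proof -
  have "lie_bracket A X Y \<in> vfields A UNIV"
    unfolding lie_bracket_eq_nabla[OF assms]
    by (intro vfields_diff nabla_closed open_UNIV lie_algebra_vfields assms)
  then show ?thesis
    using lie_bracket_left_invariant[OF assms] unfolding lie_algebra_def by blast
qed

text \<open>Orthonormalize the tangent space at \<open>\<one>\<close> in a chart and translate: left-invariance of the metric keeps the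
  fields orthonormal at every point.\<close>

lemma left_invariant_frame_exists:
  "\<exists>E. orthonormal_frame A h UNIV E \<and> (\<forall>i<mfd_dim A. E i \<in> lie_algebra G A)"
proof -
  obtain c where c: "c \<in> A" "\<one> \<in> fst c" by (rule chart_at)
  define Q where "Q x y = h \<one> (dir_deriv A c \<one> x) (dir_deriv A c \<one> y)" for x y
  have T: "dir_deriv A c \<one> x \<in> tangent_space A \<one>" for x
    using tangent_space_eq[OF c] by simp
  have "linear (\<lambda>x. Q x y)" for y
    unfolding Q_def by (rule chart_form_linear[OF c])
  moreover have "Q x y = Q y x" for x y
    unfolding Q_def by (rule metric_sym[OF T T])
  moreover have "Q x x > 0" if "x \<noteq> 0" for x
    unfolding Q_def using metric_pos[OF T] dir_deriv_eq_0_iff[OF c] that by blast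
  ultimately obtain w where w: "orthonormal_family Q (mfd_dim A) w"
    using orthonormal_family_exists[OF _ _ _ finite_dim, of Q] unfolding mfd_dim_def by blast
  define E where "E i = (\<lambda>a. left_push G a (dir_deriv A c \<one> (w i)))" for i
  have Eg: "E i \<in> lie_algebra G A" for i
    unfolding E_def by (rule left_invariant_extension[OF T])
  have E1: "E i \<one> = dir_deriv A c \<one> (w i)" for i
    by (simp add: E_def left_push_def)
  have "orthonormal_frame A h UNIV E"
    unfolding orthonormal_frame_def
    using w Eg lie_algebra_vfields
    by (simp add: metric_lie_algebra[OF Eg Eg] lie_inner_def E1 orthonormal_family_def Q_def)
  then show ?thesis using Eg by blast
qed

lemma harmonic_iff_parallel:
  assumes "\<xi> \<in> lie_algebra G A"
  shows "harmonic A h nabla \<xi> \<longleftrightarrow> (\<forall>X\<in>vfields A UNIV. nabla UNIV X \<xi> = 0)"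
proof -
  obtain E where "orthonormal_frame A h UNIV E" using left_invariant_frame_exists by blast
  then show ?thesis
    using metric_lie_algebra[OF assms assms] lie_algebra_vfields[OF assms]
    by (intro harmonic_constant_length_iff_parallel)
qed

lemma nabla_skew:
  assumes "X \<in> lie_algebra G A" "Y \<in> lie_algebra G A" "Z \<in> vfields A UNIV"
  shows "h p (nabla UNIV Z X p) (Y p) = - h p (X p) (nabla UNIV Z Y p)"
proof -
  have "0 = Z p (\<lambda>q. h q (X q) (Y q))"
    using tangent_locally_const[OF vfields_tangent[OF assms(3)] open_UNIV UNIV_I metric_lie_algebra[OF assms(1,2)]]
    by simp
  also have "\<dots> = h p (nabla UNIV Z X p) (Y p) + h p (X p) (nabla UNIV Z Y p)"
    by (rule metric_compatible) (use assms lie_algebra_vfields in auto)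
  finally show ?thesis by simp
qed

text \<open>Metric compatibility moves the derivative onto the parallel field:
  \<open>\<langle>\<nabla>\<^sub>u v, \<xi>\<rangle> = - \<langle>v, \<nabla>\<^sub>u \<xi>\<rangle> = 0\<close>, and \<open>[u, v] = \<nabla>\<^sub>u v - \<nabla>\<^sub>v u\<close>.\<close>

lemma parallel_perp_commutator:
  assumes xi: "\<xi> \<in> lie_algebra G A" and par: "\<And>X. X \<in> vfields A UNIV \<Longrightarrow> nabla UNIV X \<xi> = 0"
    and u: "u \<in> lie_algebra G A" and v: "v \<in> lie_algebra G A"
  shows "lie_inner G h \<xi> (lie_bracket A u v) = 0"
proof -
  have T: "nabla UNIV x y \<one> \<in> tangent_space A \<one>"
    if "x \<in> lie_algebra G A" "y \<in> lie_algebra G A" for x y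
    by (rule vfields_tangent[OF nabla_closed]) (use that lie_algebra_vfields in auto)
  have perp: "h \<one> (nabla UNIV x y \<one>) (\<xi> \<one>) = 0"
    if "x \<in> lie_algebra G A" "y \<in> lie_algebra G A" for x y
    using nabla_skew[OF that(2) xi lie_algebra_vfields[OF that(1)], of "\<one>"] par[OF lie_algebra_vfields[OF that(1)]]
      metric_zero_left[OF lie_algebra_tangent[OF that(2)], of "\<one>"]
      metric_sym[OF tangent_zero lie_algebra_tangent[OF that(2)], of "\<one>"] by simp
  have "lie_inner G h \<xi> (lie_bracket A u v) = h \<one> (lie_bracket A u v \<one>) (\<xi> \<one>)"
    unfolding lie_inner_def
    by (rule metric_sym) (intro lie_algebra_tangent xi lie_bracket_closed u v)+
  also have "\<dots> = h \<one> (nabla UNIV u v \<one>) (\<xi> \<one>) - h \<one> (nabla UNIV v u \<one>) (\<xi> \<one>)"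
    using metric_diff_left[OF T[OF u v] T[OF v u] lie_algebra_tangent[OF xi]]
    by (simp add: lie_bracket_eq_nabla[OF u v])
  finally show ?thesis using perp[OF u v] perp[OF v u] by simp
qed

text \<open>For parallel \<open>\<xi>\<close>, vanishing torsion reduces \<open>[\<xi>, X]\<close> to \<open>\<nabla>\<^sub>\<xi> X\<close>, and \<open>\<nabla>\<^sub>\<xi>\<close> is skew on the Lie algebra.\<close>

lemma parallel_ad_skew:
  assumes xi: "\<xi> \<in> lie_algebra G A" and par: "\<And>X. X \<in> vfields A UNIV \<Longrightarrow> nabla UNIV X \<xi> = 0"
    and X: "X \<in> lie_algebra G A" and Y: "Y \<in> lie_algebra G A"
  shows "lie_inner G h (lie_bracket A \<xi> X) Y = - lie_inner G h X (lie_bracket A \<xi> Y)"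
proof -
  have "lie_bracket A \<xi> Z = nabla UNIV \<xi> Z" if "Z \<in> lie_algebra G A" for Z
    using lie_bracket_eq_nabla[OF xi that] par[OF lie_algebra_vfields[OF that]] by simp
  then show ?thesis
    using nabla_skew[OF X Y lie_algebra_vfields[OF xi]] X Y by (simp add: lie_inner_def)
qed

text \<open>A skew map \<open>S\<close> with \<open>S(S Y) = 0\<close> satisfies \<open>|S Y|\<^sup>2 = - \<langle>Y, S(S Y)\<rangle> = 0\<close>. This lowers any vanishing
  power of \<open>S\<close> down to the first one, and nilpotency supplies a vanishing power of \<open>S = ad \<xi>\<close>.\<close>

lemma skew_ad_nilpotent_imp_central:
  assumes nil: "lower_central_series G A k = {0}" and xi: "\<xi> \<in> lie_algebra G A"
    and skew: "\<And>X Y. X \<in> lie_algebra G A \<Longrightarrow> Y \<in> lie_algebra G A \<Longrightarrow>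
      lie_inner G h (lie_bracket A \<xi> X) Y = - lie_inner G h X (lie_bracket A \<xi> Y)"
  shows "\<xi> \<in> lie_center G A"
proof -
  interpret vf: vector_space vf_scale by (rule vector_space_vf_scale)
  let ?S = "lie_bracket A \<xi>"
  have S: "?S X \<in> lie_algebra G A" if "X \<in> lie_algebra G A" for X
    by (rule lie_bracket_closed[OF xi that])
  have SjX: "(?S ^^ j) X \<in> lie_algebra G A" if "X \<in> lie_algebra G A" for j X
    by (induction j) (auto simp: that S)
  have lcs: "(?S ^^ j) X \<in> lower_central_series G A j" if "X \<in> lie_algebra G A" for j X
  proof (induction j)
    case (Suc j)
    then show ?case
      using xi by (auto intro!: vf.span_base)
  qed (simp add: that)
  have twice: "?S Y = 0" if "Y \<in> lie_algebra G A" "?S (?S Y) = 0" for Y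
  proof (rule lie_inner_eq_0D[OF S[OF that(1)]])
    have "lie_inner G h (?S Y) (?S Y) = - lie_inner G h Y 0"
      using skew[OF that(1) S[OF that(1)]] that(2) by simp
    also have "\<dots> = 0"
      using metric_zero_left[OF lie_algebra_tangent[OF that(1)], of "\<one>"]
        metric_sym[OF tangent_zero lie_algebra_tangent[OF that(1)], of "\<one>"]
      by (simp add: lie_inner_def)
    finally show "lie_inner G h (?S Y) (?S Y) = 0" .
  qed
  have descend: "?S X = 0" if "X \<in> lie_algebra G A" "(?S ^^ Suc j) X = 0" for j X
    using that(2)
  proof (induction j)
    case (Suc j)
    have "?S (?S ((?S ^^ j) X)) = 0"
      using Suc.prems by (simp only: funpow.simps o_apply)
    then have "?S ((?S ^^ j) X) = 0" by (rule twice[OF SjX[OF that(1)]])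
    then have "(?S ^^ Suc j) X = 0" by (simp only: funpow.simps o_apply)
    then show ?case by (rule Suc.IH)
  qed simp
  have "?S X = 0" if X: "X \<in> lie_algebra G A" for X
  proof (rule descend[OF X])
    (* Applying the series to S X instead of X gives a positive exponent even when k = 0. *)
    show "(?S ^^ Suc k) X = 0"
      using lcs[OF S[OF X], of k] nil by (simp add: funpow_swap1)
  qed
  then show ?thesis using xi by (simp add: lie_center_def)
qed

text \<open>The form \<open>B(X, Y) = \<langle>\<nabla>\<^sub>X \<xi>, Y\<rangle>\<close> on the Lie algebra is skew because \<open>\<xi>\<close> is central
  (\<open>\<nabla>\<^sub>X \<xi> = \<nabla>\<^sub>\<xi> X\<close> and \<open>\<nabla>\<^sub>\<xi>\<close> is skew), and symmetric because \<open>\<xi>\<close> is orthogonal to all commutators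
  (\<open>B(Y, X) - B(X, Y) = \<langle>[X, Y], \<xi>\<rangle>\<close>). So \<open>B = 0\<close>, and a left-invariant frame extends this to all
  fields.\<close>

lemma central_perp_imp_parallel:
  assumes center: "\<xi> \<in> lie_center G A"
    and perp: "\<And>u v. u \<in> lie_algebra G A \<Longrightarrow> v \<in> lie_algebra G A \<Longrightarrow> lie_inner G h \<xi> (lie_bracket A u v) = 0"
    and Z: "Z \<in> vfields A UNIV"
  shows "nabla UNIV Z \<xi> = 0"
proof -
  have xi: "\<xi> \<in> lie_algebra G A" using center by (simp add: lie_center_def)
  have T: "nabla UNIV X Y p \<in> tangent_space A p"
    if "X \<in> lie_algebra G A" "Y \<in> lie_algebra G A" for X Y p
    by (rule vfields_tangent[OF nabla_closed]) (use that lie_algebra_vfields in auto)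
  define B where "B p X Y = h p (nabla UNIV X \<xi> p) (Y p)" for p X Y
  have B_skew: "B p X Y = - B p Y X" if X: "X \<in> lie_algebra G A" and Y: "Y \<in> lie_algebra G A" for p X Y
  proof -
    have commute: "nabla UNIV W \<xi> = nabla UNIV \<xi> W" if "W \<in> lie_algebra G A" for W
      using lie_bracket_eq_nabla[OF xi that] center that by (simp add: lie_center_def)
    show ?thesis
      using nabla_skew[OF X Y lie_algebra_vfields[OF xi], of p]
        metric_sym[OF T[OF xi Y] lie_algebra_tangent[OF X]]
      by (simp add: B_def commute X Y)
  qed
  have B_sym: "B p X Y = B p Y X" if X: "X \<in> lie_algebra G A" and Y: "Y \<in> lie_algebra G A" for p X Y
  proof -
    have move: "h p (nabla UNIV V W p) (\<xi> p) = - B p V W"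
      if "V \<in> lie_algebra G A" "W \<in> lie_algebra G A" for V W
      using nabla_skew[OF that(2) xi lie_algebra_vfields[OF that(1)], of p]
        metric_sym[OF T[OF that(1) xi] lie_algebra_tangent[OF that(2)]]
      by (simp add: B_def)
    have "0 = h p (\<xi> p) (lie_bracket A X Y p)"
      using perp[OF X Y] metric_lie_algebra[OF xi lie_bracket_closed[OF X Y]] by simp
    also have "\<dots> = h p (lie_bracket A X Y p) (\<xi> p)"
      by (rule metric_sym) (intro lie_algebra_tangent xi lie_bracket_closed X Y)+
    also have "\<dots> = h p (nabla UNIV X Y p) (\<xi> p) - h p (nabla UNIV Y X p) (\<xi> p)"
      using metric_diff_left[OF T[OF X Y] T[OF Y X] lie_algebra_tangent[OF xi]]
      by (simp add: lie_bracket_eq_nabla[OF X Y])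
    finally show ?thesis using move[OF X Y] move[OF Y X] by simp
  qed
  obtain E where E: "orthonormal_frame A h UNIV E" and Eg: "\<And>i. i < mfd_dim A \<Longrightarrow> E i \<in> lie_algebra G A"
    using left_invariant_frame_exists by blast
  have "nabla UNIV (E i) \<xi> p = 0" if i: "i < mfd_dim A" for i p
  proof (rule tangent_eq_0_if_orthogonal_to_frame[OF E UNIV_I T[OF Eg[OF i] xi]])
    fix j assume "j < mfd_dim A"
    then have "B p (E i) (E j) = 0"
      using B_skew[OF Eg[OF i] Eg, of j p] B_sym[OF Eg[OF i] Eg, of j p] by simp
    then show "h p (nabla UNIV (E i) \<xi> p) (E j p) = 0" by (simp add: B_def)
  qed
  then show ?thesis
    using nabla_eq_0_from_frame[OF E Z lie_algebra_vfields[OF xi]] by (intro ext) simp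
qed

end

theorem theorem5:
  fixes G :: "'g::{t2_space,second_countable_topology} monoid"
    and A :: "('g, 'e::real_inner) chart set"
    and h :: "'g \<Rightarrow> 'g tangent \<Rightarrow> 'g tangent \<Rightarrow> real"
    and nabla :: "'g set \<Rightarrow> 'g vfield \<Rightarrow> 'g vfield \<Rightarrow> 'g vfield"
    and \<xi> :: "'g vfield"
  assumes "nilpotent_lie_group G A"
    and "simply_connected (carrier G)"
    and "left_invariant_metric G A h"
    and "levi_civita_connection A h nabla"
    and "\<xi> \<in> lie_algebra G A"
  shows "harmonic A h nabla \<xi> \<longleftrightarrow>
      \<xi> \<in> lie_center G A \<and>
      (\<forall>u\<in>lie_algebra G A. \<forall>v\<in>lie_algebra G A. lie_inner G h \<xi> (lie_bracket A u v) = 0)"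
proof -
  interpret left_invariant_levi_civita G A h nabla
    using assms(3,4) by (rule left_invariant_levi_civita.intro)
  obtain k where nil: "lower_central_series G A k = {0}"
    using nilpotent_lie_group.nilpotent[OF assms(1)] by blast
  show ?thesis
  proof
    assume "harmonic A h nabla \<xi>"
    then have par: "nabla UNIV X \<xi> = 0" if "X \<in> vfields A UNIV" for X
      using harmonic_iff_parallel[OF assms(5)] that by blast
    have "\<xi> \<in> lie_center G A"
      using skew_ad_nilpotent_imp_central[OF nil assms(5)] parallel_ad_skew[OF assms(5) par] by blast
    then show "\<xi> \<in> lie_center G A \<and>
      (\<forall>u\<in>lie_algebra G A. \<forall>v\<in>lie_algebra G A. lie_inner G h \<xi> (lie_bracket A u v) = 0)"
      using parallel_perp_commutator[OF assms(5) par] by blast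
  next
    assume "\<xi> \<in> lie_center G A \<and>
      (\<forall>u\<in>lie_algebra G A. \<forall>v\<in>lie_algebra G A. lie_inner G h \<xi> (lie_bracket A u v) = 0)"
    then show "harmonic A h nabla \<xi>"
      using central_perp_imp_parallel harmonic_iff_parallel[OF assms(5)] by blast
  qed
qed

end
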